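(* Let $n\ge 1$, let $f_1,\dots,f_n:\mathsf H\to\mathbb R$ be functions on a separable real Hilbert space $\mathsf H$, let $F=\frac1n\sum_{i=1}^n f_i$, and assume $\operatorname{argmin}F\neq\varnothing$. Assume that each $f_i$ is convex and $L$-smooth for some $L>0$, and that $F$ satisfies the Polyak–Łojasiewicz condition with constant $\mu>0$: $F(x)-F_*\le\frac1{2\mu}\|\nabla F(x)\|^2$ for all $x\in\mathsf H$. Let $(\boldsymbol x^k)_{k\in\mathbb N}$ be generated by the generic algorithm described in the context with constant step size $\alpha>0$, and suppose that the variance assumptions (B.i), (B.ii), (B.iii) described in the context hold with constants $A,B,C\ge 0$, $\rho\in[0,1]$ and a non-positive random variable $D$, where moreover $\rho>0$. Let $M>0$ be such that $M>B/\rho$ and let $\alpha>0$ be such that $\alpha<1/(A+MC)$. Set $$q=\max\Big\{1-\alpha\mu\big(1-\alpha(A+MC)\big),\;1+\frac BM-\rho\Big\}.$$ Then $q\in\,]0,1[$ and, for all $k\in\mathbb N$, $V^{k+1}\le qV^k$, where $V^k=\mathsf E[\operatorname{dist}(\boldsymbol x^k,\operatorname{argmin}F)^2]+\alpha^2M\,\mathsf E[\sigma_k^2]$. Moreover, for every $k\in\mathbb N$, $$\mathsf E[\operatorname{dist}(\boldsymbol x^k,\operatorname{argmin}F)^2]\le q^k\big(\operatorname{dist}(\boldsymbol x^0,\operatorname{argmin}F)^2+\alpha^2M\,\mathsf E[\sigma_0^2]\big),$$ $$\mathsf E[F(\boldsymbol x^k)-F_*]\le\frac{q^kL}{2}\big(\operatorname{dist}(\boldsymbol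 x^0,\operatorname{argmin}F)^2+\alpha^2M\,\mathsf E[\sigma_0^2]\big).$$
   Context: Notation: $F_*=\inf F$; $\operatorname{dist}(x,S)=\inf_{z\in S}\|x-z\|$; $\operatorname{prox}_{\varphi}(x)=\operatorname{argmin}_{y\in\mathsf H}\{\varphi(y)+\frac12\|y-x\|^2\}$. A function $f$ is $L$-smooth if it is differentiable and $\|\nabla f(x)-\nabla f(y)\|\le L\|x-y\|$ for all $x,y\in\mathsf H$. All random variables live on a probability space $(\Omega,\mathfrak A,\mathsf P)$. Generic algorithm: $(\boldsymbol e^k)_{k\in\mathbb N}$ is a sequence of random vectors in $\mathsf H$, $(i_k)_{k\in\mathbb N}$ is a sequence of i.i.d. random variables uniformly distributed on $\{1,\dots,n\}$ such that $i_k$ is independent of $\boldsymbol e^0,\dots,\boldsymbol e^{k-1}$, $\alpha>0$, the initial point $\boldsymbol x^0\in\mathsf H$ is deterministic, and for $k=0,1,\dots$ $$\boldsymbol x^{k+1}=\operatorname{prox}_{\alpha f_{i_k}}\big(\boldsymbol x^k+\alpha\boldsymbol e^k\big).$$ Variance assumptions: put $\boldsymbol v^k=\nabla f_{i_k}(\boldsymbol x^k)-\boldsymbol e^k$. There exist $A,B,C\in[0,+\infty)$, $\rho\in[0,1]$, a non-positive real-valued random variable $D$, real-valued random variables $\sigma_k$ ($k\in\mathbb N$), and $\sigma$-algebras $\mathfrak F_k\subset\mathfrak F_{k+1}\subset\mathfrak A$ such that $i_{k-1}$ (for $k\ge1$) and $\boldsymbol x^k$ are $\mathfrak F_k$-measurable,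 $i_k$ is independent of $\mathfrak F_k$, and for every $k\in\mathbb N$: (B.i) $\mathsf E[\boldsymbol e^k\mid\mathfrak F_k]=0$ a.s.; (B.ii) $\mathsf E[\|\boldsymbol v^k\|^2\mid\mathfrak F_k]\le 2A(F(\boldsymbol x^k)-F_* )+B\sigma_k^2+D$ a.s.; (B.iii) $\mathsf E[\sigma_{k+1}^2]\le(1-\rho)\mathsf E[\sigma_k^2]+2C\,\mathsf E[F(\boldsymbol x^k)-F_*]$.
   Formalization: The claim q>0 is asserted except when x^0 lies in argmin F, B=0 and ρ=1 all hold, where only 0≤q<1 is claimed: q=0 can occur there (f_1(y)=500y^2, x^0=0, e^k=σ_k=D=0, A=0.1, C=0, α=5). All other conclusions hold without exception. *)

theory Defs
  imports "HOL-Probability.Probability"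
begin

text \<open>
  On a Hilbert space a Frechet differentiable function has exactly one gradient at each point
  (Riesz), so the description below is then well defined.
\<close>

definition gradient :: "('a::real_inner \<Rightarrow> real) \<Rightarrow> 'a \<Rightarrow> 'a"
  where "gradient f x = (THE D. GDERIV f x :> D)"

definition smooth_with :: "real \<Rightarrow> ('a::real_inner \<Rightarrow> real) \<Rightarrow> bool"
  where "smooth_with L f \<longleftrightarrow>
    (\<forall>x. f differentiable (at x)) \<and>
    (\<forall>x y. norm (gradient f x - gradient f y) \<le> L * norm (x - y))"

definition argmin :: "('a \<Rightarrow> real) \<Rightarrow> 'a set"
  where "argmin f = {x. is_arg_min f (\<lambda>_. True) x}"

definition polyak_lojasiewicz :: "real \<Rightarrow> ('a::real_inner \<Rightarrow> real) \<Rightarrow> bool"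
  where "polyak_lojasiewicz \<mu> f \<longleftrightarrow>
    (\<forall>x. f x - (INF z. f z) \<le> 1 / (2 * \<mu>) * (norm (gradient f x))\<^sup>2)"

text \<open>
  For convex continuous functions on a Hilbert space the minimizer exists and is unique, so the
  choice made by \<open>ARG_MIN\<close> is immaterial.
\<close>

definition prox :: "('a::real_inner \<Rightarrow> real) \<Rightarrow> 'a \<Rightarrow> 'a"
  where "prox \<phi> x = (ARG_MIN (\<lambda>y. \<phi> y + 1 / 2 * (norm (y - x))\<^sup>2) y. True)"

text \<open>
  The library provides conditional expectations of real functions only. Vector-valued ones are
  given here, as usual, by the relation ``\<open>Y\<close> is a version of the conditional expectation of the
  integrable \<open>X\<close> given \<open>G\<close>''; such a \<open>Y\<close> is unique almost surely.
\<close>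

definition has_cond_exp ::
    "'w measure \<Rightarrow> 'w measure \<Rightarrow> ('w \<Rightarrow> 'b::{banach,second_countable_topology}) \<Rightarrow> ('w \<Rightarrow> 'b) \<Rightarrow> bool"
  where "has_cond_exp P G X Y \<longleftrightarrow>
    integrable P X \<and> integrable P Y \<and> Y \<in> borel_measurable G \<and>
    (\<forall>A\<in>sets G. (LINT \<omega>:A|P. X \<omega>) = (LINT \<omega>:A|P. Y \<omega>))"

text \<open>
  The iterates live on the probability space \<open>P\<close>; the indices are \<open>1, \<dots>, n\<close>. Independence of
  \<open>i k\<close> from \<open>e 0, \<dots>, e (k - 1)\<close> is joint, i.e. from the random vector that they form;
  \<open>vimage_algebra\<close> yields the \<open>\<sigma>\<close>-algebra generated by a random variable.
\<close>

definition generic_algorithm ::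
    "'w measure \<Rightarrow> nat \<Rightarrow> (nat \<Rightarrow> 'a::{real_inner,banach,second_countable_topology} \<Rightarrow> real) \<Rightarrow>
     real \<Rightarrow> 'a \<Rightarrow> (nat \<Rightarrow> 'w \<Rightarrow> nat) \<Rightarrow> (nat \<Rightarrow> 'w \<Rightarrow> 'a) \<Rightarrow> (nat \<Rightarrow> 'w \<Rightarrow> 'a) \<Rightarrow> bool"
  where "generic_algorithm P n f \<alpha> x\<^sub>0 i e x \<longleftrightarrow>
    (\<forall>k. e k \<in> borel_measurable P) \<and>
    prob_space.indep_vars P (\<lambda>_. count_space {1..n}) i UNIV \<and>
    (\<forall>k. distr P (count_space {1..n}) (i k) = uniform_count_measure {1..n}) \<and>
    (\<forall>k. prob_space.indep_set P
           (sets (vimage_algebra (space P) (i k) (count_space {1..n})))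
           (sets (vimage_algebra (space P) (\<lambda>\<omega>. \<lambda>j\<in>{..<k}. e j \<omega>)
              (PiM {..<k} (\<lambda>_. borel))))) \<and>
    (\<forall>\<omega>\<in>space P. x 0 \<omega> = x\<^sub>0) \<and>
    (\<forall>k. \<forall>\<omega>\<in>space P. x (Suc k) \<omega> = prox (\<lambda>y. \<alpha> * f (i k \<omega>) y) (x k \<omega> + \<alpha> *\<^sub>R e k \<omega>))"

definition adapted_filtration ::
    "'w measure \<Rightarrow> nat \<Rightarrow> (nat \<Rightarrow> 'w \<Rightarrow> nat) \<Rightarrow>
     (nat \<Rightarrow> 'w \<Rightarrow> 'a::topological_space) \<Rightarrow> (nat \<Rightarrow> 'w measure) \<Rightarrow> bool"
  where "adapted_filtration P n i x \<FF> \<longleftrightarrow>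
    (\<forall>k. subalgebra P (\<FF> k)) \<and>
    (\<forall>k. sets (\<FF> k) \<subseteq> sets (\<FF> (Suc k))) \<and>
    (\<forall>k. i k \<in> measurable (\<FF> (Suc k)) (count_space {1..n})) \<and>
    (\<forall>k. x k \<in> borel_measurable (\<FF> k)) \<and>
    (\<forall>k. prob_space.indep_set P
           (sets (vimage_algebra (space P) (i k) (count_space {1..n}))) (sets (\<FF> k)))"

text \<open>
  Conditional and unconditional expectations of nonnegative quantities are taken in \<open>[0, \<infinity>]\<close>, so
  that no integrability of \<open>\<sigma> k\<close> or \<open>x k\<close> has to be assumed. The right-hand side of the second
  condition may a priori be negative, hence the comparison in the extended reals there
  (\<open>ennreal\<close> would truncate it at 0).
\<close>

definition variance_assumptions ::
    "'w measure \<Rightarrow> (nat \<Rightarrow> 'a::{real_inner,banach,second_countable_topology} \<Rightarrow> real) \<Rightarrow>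
     ('a \<Rightarrow> real) \<Rightarrow> (nat \<Rightarrow> 'w \<Rightarrow> nat) \<Rightarrow> (nat \<Rightarrow> 'w \<Rightarrow> 'a) \<Rightarrow> (nat \<Rightarrow> 'w \<Rightarrow> 'a) \<Rightarrow>
     (nat \<Rightarrow> 'w measure) \<Rightarrow> real \<Rightarrow> real \<Rightarrow> real \<Rightarrow> real \<Rightarrow>
     ('w \<Rightarrow> real) \<Rightarrow> (nat \<Rightarrow> 'w \<Rightarrow> real) \<Rightarrow> bool"
  where "variance_assumptions P f F i e x \<FF> A B C \<rho> D \<sigma> \<longleftrightarrow>
    (\<forall>k. has_cond_exp P (\<FF> k) (e k) (\<lambda>_. 0)) \<and>
    (\<forall>k. AE \<omega> in P.
       enn2ereal (nn_cond_exp P (\<FF> k)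
         (\<lambda>\<omega>'. ennreal ((norm (gradient (f (i k \<omega>')) (x k \<omega>') - e k \<omega>'))\<^sup>2)) \<omega>)
       \<le> ereal (2 * A * (F (x k \<omega>) - (INF z. F z)) + B * (\<sigma> k \<omega>)\<^sup>2 + D \<omega>)) \<and>
    (\<forall>k. (\<integral>\<^sup>+ \<omega>. ennreal ((\<sigma> (Suc k) \<omega>)\<^sup>2) \<partial>P)
       \<le> ennreal (1 - \<rho>) * (\<integral>\<^sup>+ \<omega>. ennreal ((\<sigma> k \<omega>)\<^sup>2) \<partial>P)
         + ennreal (2 * C) * (\<integral>\<^sup>+ \<omega>. ennreal (F (x k \<omega>) - (INF z. F z)) \<partial>P))"

end

theory Submission
  imports Defs
begin

text \<open>
  Write \<open>x\<close>, \<open>p\<close> for two consecutive iterates and \<open>v\<close> for \<open>gradient (f i) x - e\<close>. The variational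
  inequality of the proximal map and convexity of \<open>f i\<close> give, pointwise and for every \<open>z\<close>,
  \<open>(dist p z)\<^sup>2 + 2 \<alpha> (f i x - f i z) \<le> (dist x z)\<^sup>2 + \<alpha>\<^sup>2 (norm v)\<^sup>2 + 2 \<alpha> (e \<bullet> (x - z))\<close>.
  Take for \<open>z\<close> an almost nearest minimizer of \<open>F\<close> that depends measurably on \<open>x\<close>. In expectation the
  last term vanishes and \<open>f i x - f i z\<close> becomes \<open>F x - min F\<close>. Adding the recursion for \<open>\<sigma>\<close> with weight
  \<open>\<alpha>\<^sup>2 M\<close> leaves the gap \<open>F x - min F\<close> with coefficient \<open>- 2 \<alpha> (1 - \<alpha> (A + M C))\<close>, and the
  Polyak-Lojasiewicz condition bounds this gap below by \<open>\<mu> / 2\<close> times the squared distance to the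
  minimizers. Positivity of \<open>q\<close> is only in question for \<open>B = 0\<close> and \<open>\<rho> = 1\<close>; then the mean of \<open>v\<close> at
  \<open>x\<^sub>0\<close> is \<open>gradient F x\<^sub>0\<close>, so \<open>2 \<mu> (F x\<^sub>0 - min F) \<le> 2 A (F x\<^sub>0 - min F)\<close>, whence \<open>\<mu> \<le> A\<close> unless
  \<open>x\<^sub>0\<close> is a minimizer.
\<close>

section \<open>Proximal maps and gradients\<close>

text \<open>The quadratic term makes the objective strongly convex, so minimizing sequences are
  Cauchy and completeness provides the minimizer; this replaces a weak compactness argument.\<close>

lemma prox_objective_has_minimizer:
  fixes \<phi> :: "'a::{real_inner,banach} \<Rightarrow> real"
  assumes cvx: "convex_on UNIV \<phi>" and cont: "continuous_on UNIV \<phi>"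
    and lower: "\<And>y. c - K * norm (y - w) \<le> \<phi> y"
  shows "\<exists>p. is_arg_min (\<lambda>y. \<phi> y + 1 / 2 * (norm (y - w))\<^sup>2) (\<lambda>_. True) p"
proof -
  define G where "G = (\<lambda>y. \<phi> y + 1 / 2 * (norm (y - w))\<^sup>2)"
  have bdd: "bdd_below (range G)"
  proof (rule bdd_belowI2)
    fix y
    \<comment> \<open>Completing the square absorbs the linear lower bound into the quadratic term
      at the cost of \<open>K\<^sup>2 / 2\<close>.\<close>
    have "0 \<le> (norm (y - w) - K)\<^sup>2" by simp
    then show "c - K\<^sup>2 / 2 \<le> G y"
      using lower[of y] by (simp add: G_def power2_diff mult.commute)
  qed
  define m where "m = (INF y. G y)"
  have m_le: "m \<le> G y" for y
    unfolding m_def by (rule cINF_lower[OF bdd]) simp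
  \<comment> \<open>By the parallelogram identity at the midpoint \<open>u\<close>, whose value is
    at least \<open>m\<close>, two almost minimal points are close to each other.\<close>
  have mid: "(norm (a - b))\<^sup>2 \<le> 4 * ((G a - m) + (G b - m))" for a b
  proof -
    define u where "u = (1/2) *\<^sub>R a + (1/2) *\<^sub>R b"
    have "\<phi> u \<le> (1/2) * \<phi> a + (1/2) * \<phi> b"
      unfolding u_def using convex_onD[OF cvx, of "1/2" a b] by simp
    moreover have "(norm (u - w))\<^sup>2 = (norm (a - w))\<^sup>2 / 2 + (norm (b - w))\<^sup>2 / 2 - (norm (a - b))\<^sup>2 / 4"
    proof -
      have "u - w = (1/2) *\<^sub>R ((a - w) + (b - w))"
        by (simp add: u_def algebra_simps flip: scaleR_left.add)
      then have "(norm (u - w))\<^sup>2 = (norm ((a - w) + (b - w)))\<^sup>2 / 4"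
        by (simp add: power_divide)
      moreover have "(norm (a - b))\<^sup>2 = (norm ((a - w) - (b - w)))\<^sup>2" by simp
      ultimately show ?thesis
        unfolding power2_norm_eq_inner
        by (simp add: inner_add_left inner_add_right inner_diff_left inner_diff_right inner_commute field_simps)
    qed
    moreover have "m \<le> G u" by (rule m_le)
    ultimately show ?thesis by (simp add: G_def field_simps)
  qed
  have "\<exists>y. G y < m + 1 / real (Suc k)" for k
    using cInf_lessD[of "range G" "m + 1 / real (Suc k)"] by (auto simp: m_def)
  then obtain y where y: "\<And>k. G (y k) < m + 1 / real (Suc k)" by metis
  have "Cauchy y"
  proof (rule metric_CauchyI)
    fix r :: real assume r: "0 < r"
    \<comment> \<open>Two gaps below \<open>r\<^sup>2 / 8\<close>, multiplied by the 4 in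
      \<open>mid\<close>, add up to \<open>r\<^sup>2\<close>.\<close>
    obtain N where N: "1 / real (Suc N) < r\<^sup>2 / 8"
      using reals_Archimedean[of "r\<^sup>2 / 8"] r by (auto simp: inverse_eq_divide)
    have "dist (y a) (y b) < r" if "N \<le> a" "N \<le> b" for a b
    proof -
      have "1 / real (Suc a) \<le> 1 / real (Suc N)" "1 / real (Suc b) \<le> 1 / real (Suc N)"
        using that by (auto intro!: divide_left_mono)
      with y[of a] y[of b] N have "G (y a) - m < r\<^sup>2 / 8" "G (y b) - m < r\<^sup>2 / 8" by linarith+
      then have "4 * ((G (y a) - m) + (G (y b) - m)) < 4 * (r\<^sup>2 / 8 + r\<^sup>2 / 8)"
        by (intro mult_strict_left_mono add_strict_mono) auto
      also have "\<dots> = r\<^sup>2" by simp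
      finally have "(norm (y a - y b))\<^sup>2 < r\<^sup>2" using mid[of "y a" "y b"] by linarith
      then show ?thesis using r by (auto simp: dist_norm intro: power2_less_imp_less)
    qed
    then show "\<exists>M. \<forall>a\<ge>M. \<forall>b\<ge>M. dist (y a) (y b) < r" by blast
  qed
  then obtain p where p: "y \<longlonglongrightarrow> p" using Cauchy_convergent convergent_def by blast
  have "continuous_on UNIV G" unfolding G_def by (intro continuous_intros cont)
  then have "(\<lambda>k. G (y k)) \<longlonglongrightarrow> G p"
    using p by (auto simp: continuous_on_eq_continuous_at dest: isCont_tendsto_compose)
  moreover have "(\<lambda>k. m + 1 / real (Suc k)) \<longlonglongrightarrow> m + 0"
    using LIMSEQ_inverse_real_of_nat by (intro tendsto_intros) (simp add: inverse_eq_divide)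
  ultimately have "G p \<le> m"
    using y by (intro LIMSEQ_le[of "\<lambda>k. G (y k)" _ "\<lambda>k. m + 1 / real (Suc k)"]) (auto intro: less_imp_le)
  with m_le have "is_arg_min G (\<lambda>_. True) p"
    by (auto simp: is_arg_min_def not_less intro: order_trans)
  then show ?thesis unfolding G_def by blast
qed

text \<open>First-order optimality: compare \<open>p\<close> with the points \<open>u\<close> of the
  segment from \<open>p\<close> to \<open>z\<close>, divide by \<open>t\<close> and let
  \<open>t\<close> tend to 0, which removes the second-order remainder.\<close>

lemma prox_minimizer_variational_ineq:
  fixes \<phi> :: "'a::real_inner \<Rightarrow> real"
  assumes cvx: "convex_on UNIV \<phi>"
    and min: "is_arg_min (\<lambda>y. \<phi> y + 1 / 2 * (norm (y - w))\<^sup>2) (\<lambda>_. True) p"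
  shows "\<phi> p + (w - p) \<bullet> (z - p) \<le> \<phi> z"
proof -
  have "\<phi> p + (w - p) \<bullet> (z - p) \<le> \<phi> z + t / 2 * (norm (z - p))\<^sup>2" if t: "0 < t" "t < 1" for t
  proof -
    define u where "u = (1 - t) *\<^sub>R p + t *\<^sub>R z"
    have 1: "\<phi> u \<le> (1 - t) * \<phi> p + t * \<phi> z"
      unfolding u_def using convex_onD[OF cvx, of t p z] t by simp
    have uw: "u - w = (p - w) + t *\<^sub>R (z - p)" by (simp add: u_def algebra_simps)
    have 2: "(norm (u - w))\<^sup>2 = (norm (p - w))\<^sup>2 - 2 * t * ((w - p) \<bullet> (z - p)) + t\<^sup>2 * (norm (z - p))\<^sup>2"
      unfolding uw using dot_norm[of "p - w" "t *\<^sub>R (z - p)"] inner_minus_left[of "p - w" "z - p"]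
      by (simp add: power_mult_distrib del: inner_minus_left)
    have 3: "\<phi> p + 1 / 2 * (norm (p - w))\<^sup>2 \<le> \<phi> u + 1 / 2 * (norm (u - w))\<^sup>2"
      using min by (simp add: is_arg_min_def not_less)
    have "t * (\<phi> p + (w - p) \<bullet> (z - p)) \<le> t * (\<phi> z + t / 2 * (norm (z - p))\<^sup>2)"
      using 1 2 3 by (simp add: algebra_simps power2_eq_square)
    with t show ?thesis by simp
  qed
  then have "\<forall>\<^sub>F t in at_right 0. \<phi> p + (w - p) \<bullet> (z - p) \<le> \<phi> z + t / 2 * (norm (z - p))\<^sup>2"
    unfolding eventually_at_right_field by (intro exI[of _ 1]) auto
  moreover have "((\<lambda>t. \<phi> z + t / 2 * (norm (z - p))\<^sup>2) \<longlongrightarrow> \<phi> z + 0 / 2 * (norm (z - p))\<^sup>2) (at_right 0)"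
    by (intro tendsto_intros) auto
  ultimately have "\<phi> p + (w - p) \<bullet> (z - p) \<le> \<phi> z + 0 / 2 * (norm (z - p))\<^sup>2"
    by (intro tendsto_lowerbound) auto
  then show ?thesis by simp
qed

text \<open>The representing vector is the proximal point \<open>p\<close> of \<open>- g\<close> at
  0. Its variational inequality gives \<open>g h \<le> h \<bullet> p\<close>, and replacing
  \<open>h\<close> by \<open>- h\<close> gives equality.\<close>

lemma riesz_representation:
  fixes g :: "'a::{real_inner,banach} \<Rightarrow> real"
  assumes "bounded_linear g"
  shows "\<exists>D. \<forall>h. g h = h \<bullet> D"
proof -
  interpret bounded_linear g by fact
  obtain K where K: "\<And>y. norm (g y) \<le> norm y * K" using bounded by blast
  have cvx: "convex_on UNIV (\<lambda>y. - g y)"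
    by (intro convex_onI) (auto simp: add scaleR)
  moreover have "continuous_on UNIV (\<lambda>y. - g y)"
    by (intro continuous_intros continuous_on)
  moreover have "0 - K * norm (y - 0) \<le> - g y" for y
    using K[of y] by (simp add: mult.commute)
  ultimately obtain p where
    p: "is_arg_min (\<lambda>y. - g y + 1 / 2 * (norm (y - 0))\<^sup>2) (\<lambda>_. True) p"
    using prox_objective_has_minimizer[of "\<lambda>y. - g y" 0 K 0] by auto
  have le: "g h \<le> h \<bullet> p" for h
    using prox_minimizer_variational_ineq[OF cvx p, of "p + h"] by (simp add: add inner_commute)
  have "g h = h \<bullet> p" for h
    using le[of h] le[of "- h"] by (simp add: neg)
  then show ?thesis by blast
qed

section \<open>Gradients and first-order inequalities\<close>

lemma GDERIV_gradient:
  fixes f :: "'a::{real_inner,banach} \<Rightarrow> real"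
  assumes "f differentiable (at x)"
  shows "GDERIV f x :> gradient f x"
proof -
  obtain f' where f': "(f has_derivative f') (at x)" using assms by (auto simp: differentiable_def)
  then obtain D where "\<And>h. f' h = h \<bullet> D"
    using riesz_representation has_derivative_bounded_linear by blast
  then have "f' = (\<lambda>h. h \<bullet> D)" by (rule ext)
  with f' have D: "GDERIV f x :> D" by (simp add: gderiv_def)
  have unique: "D1 = D2" if "GDERIV f x :> D1" "GDERIV f x :> D2" for D1 D2
  proof -
    have "(\<lambda>h. h \<bullet> D1) = (\<lambda>h. h \<bullet> D2)"
      using that unfolding gderiv_def by (rule has_derivative_unique)
    then have "(D1 - D2) \<bullet> D1 = (D1 - D2) \<bullet> D2" by (rule fun_cong)
    then have "(D1 - D2) \<bullet> (D1 - D2) = 0" by (simp add: inner_diff_right)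
    then show ?thesis by simp
  qed
  show ?thesis unfolding gradient_def by (rule theI) (fact D, rule unique[OF _ D])
qed

lemma gradient_eqI:
  fixes f :: "'a::{real_inner,banach} \<Rightarrow> real"
  assumes "GDERIV f x :> D"
  shows "gradient f x = D"
proof -
  have "f differentiable (at x)" using assms unfolding gderiv_def differentiable_def by blast
  then have "GDERIV f x :> gradient f x" by (rule GDERIV_gradient)
  then have "(\<lambda>h. h \<bullet> gradient f x) = (\<lambda>h. h \<bullet> D)"
    using assms unfolding gderiv_def by (rule has_derivative_unique)
  then have "h \<bullet> gradient f x = h \<bullet> D" for h by (rule fun_cong)
  then show ?thesis by (subst vector_eq_ldot[symmetric]) simp
qed

lemma DERIV_along_line:
  fixes f :: "'a::{real_inner,banach} \<Rightarrow> real"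
  assumes "\<And>x. f differentiable (at x)"
  shows "((\<lambda>t. f (x + t *\<^sub>R h)) has_real_derivative (h \<bullet> gradient f (x + t *\<^sub>R h))) (at t)"
proof -
  have "(f has_derivative (\<lambda>k. k \<bullet> gradient f (x + t *\<^sub>R h))) (at (x + t *\<^sub>R h))"
    using GDERIV_gradient[OF assms] by (simp add: gderiv_def)
  moreover have "((\<lambda>t. x + t *\<^sub>R h) has_derivative (\<lambda>s. s *\<^sub>R h)) (at t)"
    by (auto intro!: derivative_eq_intros)
  ultimately have "((\<lambda>t. f (x + t *\<^sub>R h)) has_derivative (\<lambda>s. (s *\<^sub>R h) \<bullet> gradient f (x + t *\<^sub>R h))) (at t)"
    using has_derivative_compose by fastforce
  then show ?thesis by (simp add: has_field_derivative_def mult.commute[of _ "h \<bullet> _"])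
qed

text \<open>Restricted to the line through \<open>x\<close> and \<open>y\<close> the function is
  convex on the reals and lies above its tangent at parameter 0.\<close>

lemma convex_gradient_ineq:
  fixes f :: "'a::{real_inner,banach} \<Rightarrow> real"
  assumes "convex_on UNIV f" and "\<And>x. f differentiable (at x)"
  shows "f x + gradient f x \<bullet> (y - x) \<le> f y"
proof -
  have "convex_on UNIV (\<lambda>t. f (x + t *\<^sub>R (y - x)))"
  proof (rule convex_onI)
    fix t a b :: real assume t: "0 < t" "t < 1"
    have "x + ((1 - t) *\<^sub>R a + t *\<^sub>R b) *\<^sub>R (y - x)
      = (1 - t) *\<^sub>R (x + a *\<^sub>R (y - x)) + t *\<^sub>R (x + b *\<^sub>R (y - x))"
      by (simp add: algebra_simps)
    then show "f (x + ((1 - t) *\<^sub>R a + t *\<^sub>R b) *\<^sub>R (y - x))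
      \<le> (1 - t) * f (x + a *\<^sub>R (y - x)) + t * f (x + b *\<^sub>R (y - x))"
      using convex_onD[OF assms(1), of t] t by simp
  qed simp
  from convex_on_imp_above_tangent[OF this, of 0 1 "(y - x) \<bullet> gradient f x"]
    DERIV_along_line[OF assms(2), of x "y - x" 0]
  show ?thesis by (simp add: inner_commute)
qed

text \<open>The tangent at \<open>w\<close> supplies the lower bound under which a minimizer exists,
  with \<open>K\<close> the norm of the gradient there. Hence the choice made by \<open>prox\<close>
  is indeed a minimizer.\<close>

lemma prox_variational_ineq:
  fixes \<phi> :: "'a::{real_inner,banach} \<Rightarrow> real"
  assumes cvx: "convex_on UNIV \<phi>" and diff: "\<And>x. \<phi> differentiable (at x)"
  shows "\<phi> (prox \<phi> w) + (w - prox \<phi> w) \<bullet> (z - prox \<phi> w) \<le> \<phi> z"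
proof -
  have "\<phi> w - norm (gradient \<phi> w) * norm (y - w) \<le> \<phi> y" for y
    using convex_gradient_ineq[OF cvx diff, of w y] Cauchy_Schwarz_ineq2[of "gradient \<phi> w" "y - w"]
    by (simp add: abs_le_iff)
  moreover have "continuous_on UNIV \<phi>"
    using diff by (simp add: continuous_on_eq_continuous_at differentiable_imp_continuous_within)
  ultimately have "\<exists>p. is_arg_min (\<lambda>y. \<phi> y + 1 / 2 * (norm (y - w))\<^sup>2) (\<lambda>_. True) p"
    using prox_objective_has_minimizer[OF cvx] by blast
  then have "is_arg_min (\<lambda>y. \<phi> y + 1 / 2 * (norm (y - w))\<^sup>2) (\<lambda>_. True) (prox \<phi> w)"
    unfolding prox_def arg_min_def by (rule someI_ex)
  then show ?thesis by (rule prox_minimizer_variational_ineq[OF cvx])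
qed

lemma descent_lemma:
  fixes f :: "'a::{real_inner,banach} \<Rightarrow> real"
  assumes "smooth_with L f"
  shows "f y \<le> f x + gradient f x \<bullet> (y - x) + L / 2 * (norm (y - x))\<^sup>2"
proof -
  define h where "h = y - x"
  have diff: "\<And>x. f differentiable (at x)"
    and lip: "\<And>x y. norm (gradient f x - gradient f y) \<le> L * norm (x - y)"
    using assms by (auto simp: smooth_with_def)
  \<comment> \<open>\<open>\<psi>\<close> is \<open>f\<close> along the segment minus the claimed
    upper bound without its constant term \<open>f x\<close>. The Lipschitz gradient makes it
    nonincreasing, and \<open>\<psi> 1 \<le> \<psi> 0\<close> is the claim.\<close>
  define \<psi> where "\<psi> = (\<lambda>t. f (x + t *\<^sub>R h) - t * (h \<bullet> gradient f x) - L / 2 * t\<^sup>2 * (norm h)\<^sup>2)"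
  have "\<psi> 1 \<le> \<psi> 0"
  proof (rule DERIV_nonpos_imp_nonincreasing[of 0 1 \<psi>])
    fix t :: real assume t: "0 \<le> t"
    have "h \<bullet> (gradient f (x + t *\<^sub>R h) - gradient f x) \<le> norm h * (L * norm (t *\<^sub>R h))"
      using lip[of "x + t *\<^sub>R h" x]
      by (intro order_trans[OF norm_cauchy_schwarz] mult_left_mono) auto
    also have "\<dots> = L * t * (norm h)\<^sup>2" using t by (simp add: power2_eq_square)
    finally have "h \<bullet> gradient f (x + t *\<^sub>R h) - h \<bullet> gradient f x - L * t * (norm h)\<^sup>2 \<le> 0"
      by (simp add: inner_diff_right)
    moreover have "(\<psi> has_real_derivative
        (h \<bullet> gradient f (x + t *\<^sub>R h) - h \<bullet> gradient f x - L * t * (norm h)\<^sup>2)) (at t)"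
      unfolding \<psi>_def by (rule derivative_eq_intros DERIV_along_line[OF diff] refl | simp)+
    ultimately show "\<exists>y. (\<psi> has_real_derivative y) (at t) \<and> y \<le> 0" by blast
  qed simp
  then show ?thesis by (simp add: \<psi>_def h_def inner_commute)
qed

section \<open>Minimizers: function gap against squared distance\<close>

lemma mem_argmin_iff: "z \<in> argmin f \<longleftrightarrow> (\<forall>y. f z \<le> f y)"
  for f :: "'a \<Rightarrow> real"
  by (auto simp: argmin_def is_arg_min_def not_less)

lemma INF_eq_argmin: "z \<in> argmin f \<Longrightarrow> (INF y. f y) = f z"
  for f :: "'a \<Rightarrow> real"
  by (rule cInf_eq_minimum) (auto simp: mem_argmin_iff)

text \<open>
  Along gradient descent with step size \<open>\<eta>\<close>, the Polyak-Lojasiewicz inequality bounds the length of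
  each step by the decrease of \<open>sqrt (F - min F)\<close>, so the iterates converge to a minimizer whose
  distance from the start is controlled. The sharp constant appears for \<open>\<eta> \<rightarrow> 0\<close>.
\<close>

lemma convex_PL_quadratic_growth:
  fixes F :: "'a::{real_inner,banach} \<Rightarrow> real"
  assumes cvx: "convex_on UNIV F" and smooth: "smooth_with L F" and L: "0 < L"
    and \<mu>: "0 < \<mu>" and PL: "polyak_lojasiewicz \<mu> F" and ne: "argmin F \<noteq> {}"
  shows "\<mu> / 2 * (infdist x (argmin F))\<^sup>2 \<le> F x - (INF y. F y)"
proof -
  have diff: "\<And>x. F differentiable (at x)"
    and lip: "\<And>x y. norm (gradient F x - gradient F y) \<le> L * norm (x - y)"
    using smooth by (auto simp: smooth_with_def)
  define m where "m = (INF y. F y)"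
  obtain z where z: "z \<in> argmin F" using ne by blast
  have m: "m = F z" using INF_eq_argmin[OF z] by (simp add: m_def)
  have m_le: "m \<le> F y" for y using z by (simp add: m mem_argmin_iff)
  have PL': "2 * \<mu> * (F y - m) \<le> (norm (gradient F y))\<^sup>2" for y
    using PL \<mu> by (simp add: polyak_lojasiewicz_def m_def field_simps)
  \<comment> \<open>The decrease of the square root of the gap, rather than of the gap itself,
    controls the length of a gradient step.\<close>
  define s where "s = (\<lambda>y. sqrt (F y - m))"
  have s_nonneg: "0 \<le> s y" for y using m_le by (simp add: s_def)
  have s_sq: "(s y)\<^sup>2 = F y - m" for y using m_le by (simp add: s_def)
  have bound: "(1 - L * \<eta>) * sqrt (\<mu> / 2) * infdist x (argmin F) \<le> s x"
    if \<eta>: "0 < \<eta>" "L * \<eta> < 1" for \<eta>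
  proof -
    define \<kappa> where "\<kappa> = (1 - L * \<eta>) * sqrt (\<mu> / 2)"
    have \<kappa>: "0 < \<kappa>" using \<eta> \<mu> by (simp add: \<kappa>_def)
    define T where "T = (\<lambda>y. y - \<eta> *\<^sub>R gradient F y)"
    have step: "\<kappa> * norm (T y - y) \<le> s y - s (T y)" for y
    proof (cases "gradient F y = 0")
      case True
      then show ?thesis by (simp add: T_def)
    next
      case False
      define g where "g = norm (gradient F y)"
      have g: "0 < g" using False by (simp add: g_def)
      have n: "norm (T y - y) = \<eta> * g" using \<eta> by (simp add: T_def g_def)
      \<comment> \<open>Convexity is used at \<open>T y\<close>; replacing the gradient there by the
        one at \<open>y\<close> costs the share \<open>L * \<eta>\<close> of the decrease and leaves
        the factor \<open>1 - L * \<eta>\<close> in \<open>desc\<close>.\<close>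
      have 1: "F (T y) \<le> F y - gradient F (T y) \<bullet> (y - T y)"
        using convex_gradient_ineq[OF cvx diff, of "T y" y] by simp
      have 2: "gradient F y \<bullet> (y - T y) = \<eta> * g\<^sup>2"
        by (simp add: T_def g_def power2_norm_eq_inner)
      have "\<bar>(gradient F (T y) - gradient F y) \<bullet> (y - T y)\<bar> \<le> (L * norm (T y - y)) * norm (y - T y)"
        by (intro order_trans[OF Cauchy_Schwarz_ineq2] mult_right_mono lip) auto
      then have 3: "(gradient F (T y) - gradient F y) \<bullet> (y - T y) \<ge> - (L * (\<eta> * g) * (\<eta> * g))"
        using n by (simp add: norm_minus_commute abs_le_iff)
      from 1 2 3 have desc: "F (T y) \<le> F y - \<eta> * (1 - L * \<eta>) * g\<^sup>2"
        by (simp add: inner_diff_left algebra_simps power2_eq_square)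
      \<comment> \<open>The product is the difference of the squares of \<open>s y\<close> and
        \<open>s (T y)\<close>, that is, \<open>F y - F (T y)\<close>.\<close>
      then have "(s y - s (T y)) * (s y + s (T y)) \<ge> \<eta> * (1 - L * \<eta>) * g\<^sup>2"
        using s_sq[of y] s_sq[of "T y"] by (simp add: algebra_simps power2_eq_square)
      moreover have "s (T y) \<le> s y"
        using desc \<eta> g unfolding s_def
        by (intro real_sqrt_le_mono) (smt (verit) mult_nonneg_nonneg zero_le_power2)
      \<comment> \<open>This is the Polyak-Lojasiewicz inequality after taking square roots.\<close>
      moreover have "sqrt (\<mu> / 2) * (2 * s y) \<le> g"
      proof (rule power2_le_imp_le)
        show "(sqrt (\<mu> / 2) * (2 * s y))\<^sup>2 \<le> g\<^sup>2"
          using PL'[of y] \<mu> by (simp add: power_mult_distrib s_sq g_def algebra_simps)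
      qed (use g in simp)
      ultimately have "\<eta> * (1 - L * \<eta>) * g\<^sup>2 * sqrt (\<mu> / 2) \<le> (s y - s (T y)) * g"
      proof -
        assume 1: "\<eta> * (1 - L * \<eta>) * g\<^sup>2 \<le> (s y - s (T y)) * (s y + s (T y))"
          and 2: "s (T y) \<le> s y" and 3: "sqrt (\<mu> / 2) * (2 * s y) \<le> g"
        have "\<eta> * (1 - L * \<eta>) * g\<^sup>2 * sqrt (\<mu> / 2) \<le> (s y - s (T y)) * (s y + s (T y)) * sqrt (\<mu> / 2)"
          using 1 \<mu> by (intro mult_right_mono) auto
        also have "\<dots> = (s y - s (T y)) * (sqrt (\<mu> / 2) * (s y + s (T y)))" by simp
        also have "\<dots> \<le> (s y - s (T y)) * (sqrt (\<mu> / 2) * (2 * s y))"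
          using 2 \<mu> by (intro mult_left_mono) auto
        also have "\<dots> \<le> (s y - s (T y)) * g" using 2 3 by (intro mult_left_mono) auto
        finally show ?thesis .
      qed
      then have "(\<eta> * g * \<kappa>) * g \<le> (s y - s (T y)) * g"
        by (simp add: \<kappa>_def power2_eq_square algebra_simps)
      then show ?thesis using g n by (simp add: mult.commute)
    qed
    define u where "u = (\<lambda>t. (T ^^ t) x)"
    have u_Suc: "u (Suc t) = T (u t)" for t by (simp add: u_def)
    \<comment> \<open>The step bound telescopes, so the whole trajectory has length at most
      \<open>s x / \<kappa>\<close> and converges.\<close>
    have "\<kappa> * (\<Sum>t<N. norm (u (Suc t) - u t)) \<le> s (u 0) - s (u N)" for N
    proof (induction N)
      case (Suc N)
      with step[of "u N"] show ?case by (simp add: distrib_left u_Suc)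
    qed simp
    then have partial: "(\<Sum>t<N. norm (u (Suc t) - u t)) \<le> s x / \<kappa>" for N
      using s_nonneg[of "u N"] \<kappa> by (simp add: field_simps u_def) (smt (verit))
    then have summ: "summable (\<lambda>t. norm (u (Suc t) - u t))"
      by (intro summableI_nonneg_bounded) auto
    define p where "p = x + (\<Sum>t. u (Suc t) - u t)"
    have "(\<lambda>N. x + (\<Sum>t<N. u (Suc t) - u t)) \<longlonglongrightarrow> p"
      unfolding p_def by (intro tendsto_intros summable_LIMSEQ summable_norm_cancel[OF summ])
    then have u_lim: "u \<longlonglongrightarrow> p"
      by (simp add: sum_lessThan_telescope) (simp add: u_def)
    have "norm (\<Sum>t. u (Suc t) - u t) \<le> s x / \<kappa>"
      using summable_norm[OF summ] suminf_le_const[OF summ partial] by linarith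
    then have dist: "dist x p \<le> s x / \<kappa>" by (simp add: p_def dist_norm)
    \<comment> \<open>The increments are \<open>- \<eta>\<close> times the gradients and tend to 0,
      so the gradient vanishes at the limit; convexity then makes \<open>p\<close> a
      minimizer.\<close>
    have "gradient F p = 0"
    proof -
      have "(\<lambda>t. u (Suc t) - u t) \<longlonglongrightarrow> p - p"
        by (rule tendsto_diff[OF LIMSEQ_Suc[OF u_lim] u_lim])
      then have "(\<lambda>t. (- 1 / \<eta>) *\<^sub>R (u (Suc t) - u t)) \<longlonglongrightarrow> (- 1 / \<eta>) *\<^sub>R (p - p)"
        by (rule tendsto_scaleR[OF tendsto_const])
      then have "(\<lambda>t. gradient F (u t)) \<longlonglongrightarrow> 0"
        using \<eta> by (simp add: u_Suc T_def)
      moreover have "(\<lambda>t. gradient F (u t)) \<longlonglongrightarrow> gradient F p"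
      proof (rule LIM_zero_cancel, rule Lim_null_comparison)
        show "(\<lambda>t. L * norm (u t - p)) \<longlonglongrightarrow> 0"
          using tendsto_mult[OF tendsto_const tendsto_norm[OF LIM_zero[OF u_lim]], of L] by simp
      qed (use lip in \<open>auto intro!: always_eventually\<close>)
      ultimately show ?thesis using LIMSEQ_unique by blast
    qed
    then have "F p \<le> F y" for y
      using convex_gradient_ineq[OF cvx diff, of p y] by simp
    then have "infdist x (argmin F) \<le> s x / \<kappa>"
      using infdist_le2[of p "argmin F" x] dist by (simp add: mem_argmin_iff)
    then show ?thesis using \<kappa> by (simp add: \<kappa>_def field_simps)
  qed
  \<comment> \<open>The minimizer that is reached depends on \<open>\<eta>\<close>, but
    \<open>bound\<close> speaks of the distance to the whole set only, so \<open>\<eta>\<close> may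
    tend to 0.\<close>
  have "\<forall>\<^sub>F \<eta> in at_right 0. (1 - L * \<eta>) * sqrt (\<mu> / 2) * infdist x (argmin F) \<le> s x"
    unfolding eventually_at_right_field
  proof (intro exI[of _ "1 / L"] conjI allI impI)
    fix \<eta> assume "0 < \<eta>" "\<eta> < 1 / L"
    then show "(1 - L * \<eta>) * sqrt (\<mu> / 2) * infdist x (argmin F) \<le> s x"
      using L by (intro bound) (auto simp: field_simps)
  qed (use L in simp)
  moreover have "((\<lambda>\<eta>. (1 - L * \<eta>) * sqrt (\<mu> / 2) * infdist x (argmin F)) \<longlongrightarrow>
      (1 - L * 0) * sqrt (\<mu> / 2) * infdist x (argmin F)) (at_right 0)"
    by (intro tendsto_intros) auto
  ultimately have "(1 - L * 0) * sqrt (\<mu> / 2) * infdist x (argmin F) \<le> s x"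
    by (intro tendsto_upperbound) auto
  then have "(sqrt (\<mu> / 2) * infdist x (argmin F))\<^sup>2 \<le> (s x)\<^sup>2"
    using \<mu> by (intro power_mono) (auto simp: infdist_nonneg)
  then show ?thesis using \<mu> by (simp add: power_mult_distrib s_sq m_def)
qed

text \<open>The gradient vanishes at every minimizer, so the descent lemma based there leaves only
  the quadratic term.\<close>

lemma smooth_quadratic_upper_bound:
  fixes F :: "'a::{real_inner,banach} \<Rightarrow> real"
  assumes smooth: "smooth_with L F" and L: "0 < L" and ne: "argmin F \<noteq> {}"
  shows "F x - (INF y. F y) \<le> L / 2 * (infdist x (argmin F))\<^sup>2"
proof -
  have diff: "\<And>x. F differentiable (at x)" using smooth by (auto simp: smooth_with_def)
  have bound: "F x - (INF y. F y) \<le> L / 2 * (dist x z)\<^sup>2" if z: "z \<in> argmin F" for z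
  proof -
    have "(\<lambda>h. h \<bullet> gradient F z) = (\<lambda>h. 0)"
      using GDERIV_gradient[OF diff, of z] z unfolding gderiv_def mem_argmin_iff
      by (intro differential_zero_maxmin[of z UNIV F]) auto
    then have "(x - z) \<bullet> gradient F z = 0" by (rule fun_cong)
    then show ?thesis
      using descent_lemma[OF smooth, of x z]
      by (simp add: INF_eq_argmin[OF z] dist_norm inner_commute)
  qed
  \<comment> \<open>\<open>infdist\<close> is an infimum of distances, not of their squares; the
    bound passes to the infimum in square-root form.\<close>
  have "sqrt (2 * (F x - (INF y. F y)) / L) \<le> infdist x (argmin F)"
    unfolding infdist_notempty[OF ne]
  proof (rule cINF_greatest[OF ne])
    fix z assume "z \<in> argmin F"
    then show "sqrt (2 * (F x - (INF y. F y)) / L) \<le> dist x z"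
      using bound[of z] L by (intro real_le_lsqrt) (auto simp: field_simps)
  qed
  then have "2 * (F x - (INF y. F y)) / L \<le> (infdist x (argmin F))\<^sup>2"
    by (rule sqrt_le_D)
  then show ?thesis using L by (simp add: field_simps)
qed

text \<open>With the displacement \<open>d\<close> and \<open>a = x - z\<close>, three facts are
  added: the variational inequality at \<open>p\<close>, the tangent of \<open>f\<close> at
  \<open>x\<close> evaluated at \<open>p\<close>, and the nonnegativity of a square.\<close>

lemma prox_step_ineq:
  fixes f :: "'a::{real_inner,banach} \<Rightarrow> real" and x e z :: 'a
  assumes cvx: "convex_on UNIV f" and diff: "\<And>x. f differentiable (at x)" and \<alpha>: "0 \<le> \<alpha>"
  defines "p \<equiv> prox (\<lambda>y. \<alpha> * f y) (x + \<alpha> *\<^sub>R e)"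
  shows "(dist p z)\<^sup>2 + 2 * \<alpha> * (f x - f z)
    \<le> (dist x z)\<^sup>2 + \<alpha>\<^sup>2 * (norm (gradient f x - e))\<^sup>2 + 2 * \<alpha> * (e \<bullet> (x - z))"
proof -
  define d where "d = p - x"
  define a where "a = x - z"
  define g where "g = gradient f x"
  have "convex_on UNIV (\<lambda>y. \<alpha> * f y)" using cvx \<alpha> by (rule convex_on_cmul[rotated])
  moreover have "(\<lambda>y. \<alpha> * f y) differentiable (at y)" for y
    using diff by (intro differentiable_mult) auto
  ultimately have "\<alpha> * f p + (x + \<alpha> *\<^sub>R e - p) \<bullet> (z - p) \<le> \<alpha> * f z"
    unfolding p_def by (rule prox_variational_ineq)
  moreover have "x + \<alpha> *\<^sub>R e - p = \<alpha> *\<^sub>R e - d" "z - p = - (d + a)"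
    by (simp_all add: d_def a_def)
  ultimately have 1: "d \<bullet> d + d \<bullet> a - \<alpha> * (e \<bullet> d) - \<alpha> * (e \<bullet> a) \<le> \<alpha> * (f z - f p)"
    by (simp add: inner_simps inner_diff_left inner_commute algebra_simps)
  have "\<alpha> * (f x + g \<bullet> d) \<le> \<alpha> * f p"
    using convex_gradient_ineq[OF cvx diff, of x p] \<alpha> by (intro mult_left_mono) (auto simp: d_def g_def)
  then have 2: "\<alpha> * f x + \<alpha> * (g \<bullet> d) \<le> \<alpha> * f p" by (simp add: algebra_simps)
  \<comment> \<open>Young's inequality as a square: one copy of \<open>d \<bullet> d\<close> pays
    for the cross term of \<open>d\<close> with \<open>g - e\<close>, which leaves the squared norm
    of \<open>g - e\<close>.\<close>
  have "0 \<le> (d + \<alpha> *\<^sub>R (g - e)) \<bullet> (d + \<alpha> *\<^sub>R (g - e))" by simp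
  also have "\<dots> = d \<bullet> d + 2 * (\<alpha> * (g \<bullet> d)) - 2 * (\<alpha> * (e \<bullet> d)) + \<alpha>\<^sup>2 * (norm (g - e))\<^sup>2"
    unfolding inner_add_left inner_add_right inner_scaleR_left inner_scaleR_right power2_norm_eq_inner
    by (simp add: inner_diff_left inner_diff_right inner_commute power2_eq_square algebra_simps)
  finally have 3: "0 \<le> d \<bullet> d + 2 * (\<alpha> * (g \<bullet> d)) - 2 * (\<alpha> * (e \<bullet> d)) + \<alpha>\<^sup>2 * (norm (g - e))\<^sup>2" .
  have "p - z = d + a" by (simp add: d_def a_def)
  then have "(dist p z)\<^sup>2 = d \<bullet> d + 2 * (d \<bullet> a) + a \<bullet> a"
    by (simp add: dist_norm power2_norm_eq_inner inner_add_left inner_add_right inner_commute)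
  moreover have "(dist x z)\<^sup>2 = a \<bullet> a" by (simp add: dist_norm a_def power2_norm_eq_inner)
  ultimately show ?thesis
    using 1 2 3 unfolding g_def[symmetric] a_def[symmetric] by (simp add: algebra_simps)
qed

section \<open>Regularity of the average of the component functions\<close>

lemma GDERIV_average:
  fixes f :: "nat \<Rightarrow> 'a::{real_inner,banach} \<Rightarrow> real"
  assumes "\<And>j. j \<in> {1..n} \<Longrightarrow> f j differentiable (at y)"
  shows "GDERIV (\<lambda>y. (1 / real n) * (\<Sum>j=1..n. f j y)) y :> (1 / real n) *\<^sub>R (\<Sum>j=1..n. gradient (f j) y)"
proof -
  have "(f j has_derivative (\<lambda>h. h \<bullet> gradient (f j) y)) (at y)" if "j \<in> {1..n}" for j
    using GDERIV_gradient[OF assms[OF that]] by (simp add: gderiv_def)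
  then have "((\<lambda>y. (1 / real n) * (\<Sum>j=1..n. f j y)) has_derivative
      (\<lambda>h. (1 / real n) * (\<Sum>j=1..n. h \<bullet> gradient (f j) y))) (at y)"
    by (intro has_derivative_mult_right has_derivative_sum) auto
  then show ?thesis by (simp add: gderiv_def inner_sum_right)
qed

lemma smooth_with_average:
  fixes f :: "nat \<Rightarrow> 'a::{real_inner,banach} \<Rightarrow> real"
  assumes n: "n \<ge> 1" and smooth: "\<And>j. j \<in> {1..n} \<Longrightarrow> smooth_with L (f j)"
  shows "smooth_with L (\<lambda>y. (1 / real n) * (\<Sum>j=1..n. f j y))"
proof -
  have deriv: "GDERIV (\<lambda>y. (1 / real n) * (\<Sum>j=1..n. f j y)) y :> (1 / real n) *\<^sub>R (\<Sum>j=1..n. gradient (f j) y)" for y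
    using smooth by (intro GDERIV_average) (auto simp: smooth_with_def)
  have "norm ((1 / real n) *\<^sub>R (\<Sum>j=1..n. gradient (f j) x) - (1 / real n) *\<^sub>R (\<Sum>j=1..n. gradient (f j) y))
    \<le> L * norm (x - y)" for x y
  proof -
    have "norm (\<Sum>j=1..n. gradient (f j) x - gradient (f j) y) \<le> (\<Sum>j=1..n. L * norm (x - y))"
      using smooth by (intro sum_norm_le) (auto simp: smooth_with_def)
    then show ?thesis
      unfolding scaleR_diff_right[symmetric] sum_subtractf[symmetric] norm_scaleR
      using n by (simp add: field_simps)
  qed
  then show ?thesis
    using deriv unfolding smooth_with_def gradient_eqI[OF deriv]
    by (auto simp: gderiv_def differentiable_def)
qed

lemma convex_on_average:
  fixes f :: "nat \<Rightarrow> 'a::real_vector \<Rightarrow> real"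
  assumes "\<And>j. j \<in> {1..n} \<Longrightarrow> convex_on UNIV (f j)"
  shows "convex_on UNIV (\<lambda>y. (1 / real n) * (\<Sum>j=1..n. f j y))"
proof (rule convex_on_cmul)
  have "convex_on UNIV (\<lambda>y. \<Sum>j\<in>J. f j y)" if "finite J" "J \<subseteq> {1..n}" for J
    using that by (induction J) (auto intro!: convex_on_add assms simp: convex_on_const)
  then show "convex_on UNIV (\<lambda>y. \<Sum>j=1..n. f j y)" by simp
qed simp

section \<open>Conditioning on the past\<close>

text \<open>
  Replacing the metric projection by one with countably many values makes measurability immediate
  and works for any nonempty set, at the price of an error \<open>\<epsilon>\<close>.
\<close>

lemma measurable_approx_projection:
  fixes S :: "'a::{metric_space,second_countable_topology} set"
  assumes ne: "S \<noteq> {}" and \<epsilon>: "0 < \<epsilon>"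
  obtains \<pi> where "\<pi> \<in> borel_measurable borel" "\<And>x. \<pi> x \<in> S"
    "\<And>x. (dist x (\<pi> x))\<^sup>2 \<le> (infdist x S)\<^sup>2 + \<epsilon>"
proof -
  obtain T where T: "countable T" "T \<subseteq> S" "S \<subseteq> closure T" using separable by blast
  have T_ne: "T \<noteq> {}" using T ne by auto
  define t where "t = from_nat_into T"
  have t: "t j \<in> S" for j using T_ne T from_nat_into[of T j] by (auto simp: t_def)
  define Q where "Q = (\<lambda>j x. (dist x (t j))\<^sup>2 \<le> (infdist x S)\<^sup>2 + \<epsilon>)"
  have ex: "\<exists>j. Q j x" for x
  proof -
    define r where "r = sqrt ((infdist x S)\<^sup>2 + \<epsilon>)"
    \<comment> \<open>\<open>r\<close> exceeds the distance strictly, which leaves room to move a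
      nearly optimal \<open>z\<close> to a point of the dense set \<open>T\<close>.\<close>
    have r: "infdist x S < r" unfolding r_def using \<epsilon> by (intro real_less_rsqrt) auto
    then obtain z where z: "z \<in> S" "dist x z < r"
      using ne cInf_lessD[of "dist x ` S" r] by (auto simp: infdist_notempty)
    then obtain y where y: "y \<in> T" "dist y z < r - dist x z"
      using T(3) closure_approachable[of z T] by (metis diff_gt_0_iff_gt subsetD)
    obtain j where j: "t j = y" using y(1) T(1) from_nat_into_surj unfolding t_def by metis
    have "dist x y \<le> r"
      using y(2) dist_triangle[of x y z] by (simp add: dist_commute)
    then have "(dist x y)\<^sup>2 \<le> r\<^sup>2" by (intro power_mono) auto
    then have "Q j x" using \<epsilon> by (simp add: Q_def j r_def)
    then show ?thesis ..
  qed
  \<comment> \<open>The first admissible index is measurable in \<open>x\<close> because every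
    condition \<open>Q j\<close> describes a Borel set; by \<open>ex\<close> such an index
    exists.\<close>
  define \<pi> where "\<pi> = (\<lambda>x. t (LEAST j. Q j x))"
  have [measurable]: "(\<lambda>x. infdist x S) \<in> borel_measurable borel"
    by (intro borel_measurable_continuous_onI continuous_intros)
  have "(\<lambda>x. LEAST j. Q j x) \<in> measurable borel (count_space UNIV)"
    unfolding Q_def by measurable
  then have "\<pi> \<in> borel_measurable borel"
    unfolding \<pi>_def by (rule measurable_compose) simp
  moreover have "Q (LEAST j. Q j x) x" for x using ex by (metis LeastI)
  ultimately show ?thesis using that[of \<pi>] t by (simp add: \<pi>_def Q_def)
qed

text \<open>A bounded factor known to \<open>G\<close> can be pulled out. For simple factors the
  integral is a finite combination of integrals of \<open>X\<close> over sets of \<open>G\<close>,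
  all zero; dominated convergence gives the general case.\<close>

lemma (in finite_measure) integral_inner_eq_0_if_cond_mean_0:
  fixes X Y :: "'a \<Rightarrow> 'b::{real_inner,banach,second_countable_topology}"
  assumes sub: "subalgebra M G" and X: "integrable M X"
    and mean_0: "\<And>A. A \<in> sets G \<Longrightarrow> (LINT \<omega>:A|M. X \<omega>) = 0"
    and Y: "Y \<in> borel_measurable G" and bdd: "\<And>\<omega>. \<omega> \<in> space M \<Longrightarrow> norm (Y \<omega>) \<le> K"
  shows "integrable M (\<lambda>\<omega>. X \<omega> \<bullet> Y \<omega>)" and "(\<integral>\<omega>. X \<omega> \<bullet> Y \<omega> \<partial>M) = 0"
proof -
  have space: "space G = space M" and sets: "sets G \<subseteq> sets M"
    using sub by (auto simp: subalgebra_def)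
  note [measurable] = borel_measurable_integrable[OF X] measurable_from_subalg[OF sub Y]
  obtain s where simple: "\<And>k. simple_function G (s k)"
    and lim: "\<And>\<omega>. \<omega> \<in> space M \<Longrightarrow> (\<lambda>k. s k \<omega>) \<longlonglongrightarrow> Y \<omega>"
    and s_le: "\<And>k \<omega>. \<omega> \<in> space M \<Longrightarrow> norm (s k \<omega>) \<le> 2 * norm (Y \<omega>)"
    using borel_measurable_implies_sequence_metric[OF Y, of 0] unfolding space norm_conv_dist by metis
  have [measurable]: "s k \<in> borel_measurable M" for k
    using measurable_from_subalg[OF sub borel_measurable_simple_function[OF simple]] .
  have zero: "(\<integral>\<omega>. X \<omega> \<bullet> s k \<omega> \<partial>M) = 0" for k
  proof -
    define E where "E = (\<lambda>y. s k -` {y} \<inter> space M)"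
    have fin: "finite (s k ` space M)" and E: "y \<in> s k ` space M \<Longrightarrow> E y \<in> sets G" for y
      using simple[of k] by (auto simp: simple_function_def space E_def)
    have int: "integrable M (\<lambda>\<omega>. indicator (E y) \<omega> *\<^sub>R X \<omega>)" if "y \<in> s k ` space M" for y
      using E[OF that] sets X by (intro integrable_mult_indicator) auto
    have "X \<omega> \<bullet> s k \<omega> = (\<Sum>y\<in>s k ` space M. (indicator (E y) \<omega> *\<^sub>R X \<omega>) \<bullet> y)"
      if "\<omega> \<in> space M" for \<omega>
    proof -
      have "(\<Sum>y\<in>s k ` space M. (indicator (E y) \<omega> *\<^sub>R X \<omega>) \<bullet> y)
        = (\<Sum>y\<in>s k ` space M. if y = s k \<omega> then X \<omega> \<bullet> y else 0)"
        using that by (intro sum.cong) (auto simp: E_def indicator_def)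
      then show ?thesis using fin that by simp
    qed
    then have "(\<integral>\<omega>. X \<omega> \<bullet> s k \<omega> \<partial>M)
      = (\<integral>\<omega>. (\<Sum>y\<in>s k ` space M. (indicator (E y) \<omega> *\<^sub>R X \<omega>) \<bullet> y) \<partial>M)"
      by (intro Bochner_Integration.integral_cong) auto
    also have "\<dots> = (\<Sum>y\<in>s k ` space M. (\<integral>\<omega>. (indicator (E y) \<omega> *\<^sub>R X \<omega>) \<bullet> y \<partial>M))"
      using int by (intro Bochner_Integration.integral_sum integrable_inner_left) auto
    also have "\<dots> = (\<Sum>y\<in>s k ` space M. (LINT \<omega>:E y|M. X \<omega>) \<bullet> y)"
      unfolding set_lebesgue_integral_def using int by (intro sum.cong refl integral_inner_left) auto
    also have "\<dots> = 0" using E mean_0 by simp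
    finally show ?thesis .
  qed
  \<comment> \<open>The simple approximations are bounded by \<open>2 * norm (Y \<omega>)\<close>,
    whence the constant \<open>2 * K\<close>; the same function dominates the limit.\<close>
  have dom: "norm (X \<omega> \<bullet> y) \<le> norm (X \<omega>) * (2 * K)"
    if "\<omega> \<in> space M" "norm y \<le> 2 * norm (Y \<omega>)" for \<omega> y
    using that bdd[OF that(1)] by (intro order_trans[OF Cauchy_Schwarz_ineq2[unfolded real_norm_def[symmetric]]] mult_left_mono) auto
  show "integrable M (\<lambda>\<omega>. X \<omega> \<bullet> Y \<omega>)"
  proof (rule Bochner_Integration.integrable_bound)
    show "integrable M (\<lambda>\<omega>. norm (X \<omega>) * (2 * K))" using X by simp
    show "AE \<omega> in M. norm (X \<omega> \<bullet> Y \<omega>) \<le> norm (norm (X \<omega>) * (2 * K))"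
      using dom by (intro AE_I2) (smt (verit) norm_ge_zero real_norm_def)
  qed simp
  have "(\<lambda>k. (\<integral>\<omega>. X \<omega> \<bullet> s k \<omega> \<partial>M)) \<longlonglongrightarrow> (\<integral>\<omega>. X \<omega> \<bullet> Y \<omega> \<partial>M)"
  proof (rule integral_dominated_convergence)
    show "integrable M (\<lambda>\<omega>. norm (X \<omega>) * (2 * K))" using X by simp
    show "AE \<omega> in M. (\<lambda>k. X \<omega> \<bullet> s k \<omega>) \<longlonglongrightarrow> X \<omega> \<bullet> Y \<omega>"
      using lim by (intro AE_I2 tendsto_intros) auto
    show "AE \<omega> in M. norm (X \<omega> \<bullet> s k \<omega>) \<le> norm (X \<omega>) * (2 * K)" for k
      using dom s_le by (intro AE_I2) auto
  qed simp_all
  then show "(\<integral>\<omega>. X \<omega> \<bullet> Y \<omega> \<partial>M) = 0" by (simp add: zero LIMSEQ_const_iff)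
qed

text \<open>By independence, the indicator of the event \<open>i = j\<close> minus
  \<open>1 / n\<close> has mean 0 on every set of \<open>G\<close>. The preceding lemma, with the
  inner product of the reals, thus replaces this indicator by \<open>1 / n\<close> against
  \<open>h j\<close>.\<close>

lemma (in prob_space) uniform_index_average:
  fixes h :: "nat \<Rightarrow> 'a \<Rightarrow> real"
  assumes sub: "subalgebra M G"
    and i: "i \<in> measurable M (count_space {1..n})"
    and unif: "distr M (count_space {1..n}) i = uniform_count_measure {1..n}"
    and indep: "indep_set (sets (vimage_algebra (space M) i (count_space {1..n}))) (sets G)"
    and h: "\<And>j. j \<in> {1..n} \<Longrightarrow> h j \<in> borel_measurable G"
    and bdd: "\<And>j \<omega>. j \<in> {1..n} \<Longrightarrow> \<omega> \<in> space M \<Longrightarrow> \<bar>h j \<omega>\<bar> \<le> K"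
  shows "integrable M (\<lambda>\<omega>. h (i \<omega>) \<omega>)"
    and "(\<integral>\<omega>. h (i \<omega>) \<omega> \<partial>M) = (\<integral>\<omega>. (1 / real n) * (\<Sum>j=1..n. h j \<omega>) \<partial>M)"
proof -
  define E where "E = (\<lambda>j. i -` {j} \<inter> space M)"
  have E: "E j \<in> sets M" if "j \<in> {1..n}" for j
    using measurable_sets[OF i, of "{j}"] that by (simp add: E_def)
  have prob_E: "prob (E j) = 1 / real n" if "j \<in> {1..n}" for j
  proof -
    have "prob (E j) = measure (distr M (count_space {1..n}) i) {j}"
      using that i by (simp add: measure_distr E_def)
    then show ?thesis using that unfolding unif by (simp add: measure_uniform_count_measure)
  qed
  have h_int: "integrable M (h j)" if "j \<in> {1..n}" for j
    using that bdd measurable_from_subalg[OF sub h[OF that]]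
    by (intro integrable_const_bound[where B = K] AE_I2) auto
  have part: "integrable M (\<lambda>\<omega>. indicator (E j) \<omega> * h j \<omega>)"
    "(\<integral>\<omega>. indicator (E j) \<omega> * h j \<omega> \<partial>M) = (1 / real n) * (\<integral>\<omega>. h j \<omega> \<partial>M)"
    if j: "j \<in> {1..n}" for j
  proof -
    define X where "X = (\<lambda>\<omega>. indicator (E j) \<omega> - 1 / real n :: real)"
    have X: "integrable M X" unfolding X_def using E[OF j]
      by (intro Bochner_Integration.integrable_diff integrable_real_indicator) (auto simp: less_top[symmetric])
    have mean: "(LINT \<omega>:A|M. X \<omega>) = 0" if A: "A \<in> sets G" for A
    proof -
      have AM: "A \<in> sets M" using A sub by (auto simp: subalgebra_def)
      have "E j \<in> sets (vimage_algebra (space M) i (count_space {1..n}))"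
        unfolding E_def using j by (intro in_vimage_algebra) simp
      then have "prob (E j \<inter> A) = 1 / real n * prob A"
        using indep_setD[OF indep _ A] prob_E[OF j] by simp
      moreover have "(LINT \<omega>:A|M. X \<omega>)
        = (\<integral>\<omega>. indicator (E j \<inter> A) \<omega> - 1 / real n * indicator A \<omega> \<partial>M)"
        unfolding set_lebesgue_integral_def X_def
        by (intro Bochner_Integration.integral_cong) (auto simp: indicator_def)
      moreover have "(\<integral>\<omega>. indicator (E j \<inter> A) \<omega> - 1 / real n * indicator A \<omega> \<partial>M)
        = (\<integral>\<omega>. indicator (E j \<inter> A) \<omega> \<partial>M) - (\<integral>\<omega>. 1 / real n * indicator A \<omega> \<partial>M)"
        using E[OF j] AM
        by (intro Bochner_Integration.integral_diff integrable_mult_right integrable_real_indicator)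
          (auto simp: less_top[symmetric])
      ultimately show ?thesis using E[OF j] AM by simp
    qed
    note X_h = integral_inner_eq_0_if_cond_mean_0[OF sub X mean h[OF j], of K]
    show "integrable M (\<lambda>\<omega>. indicator (E j) \<omega> * h j \<omega>)"
      using integrable_mult_indicator[OF E[OF j] h_int[OF j]] by simp
    moreover have "(\<integral>\<omega>. X \<omega> * h j \<omega> \<partial>M) = 0" using X_h bdd[OF j] by simp
    ultimately show "(\<integral>\<omega>. indicator (E j) \<omega> * h j \<omega> \<partial>M) = (1 / real n) * (\<integral>\<omega>. h j \<omega> \<partial>M)"
      using h_int[OF j] by (simp add: X_def left_diff_distrib)
  qed
  have eq: "h (i \<omega>) \<omega> = (\<Sum>j=1..n. indicator (E j) \<omega> * h j \<omega>)" if "\<omega> \<in> space M" for \<omega>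
  proof -
    have "(\<Sum>j=1..n. indicator (E j) \<omega> * h j \<omega>) = (\<Sum>j=1..n. if j = i \<omega> then h j \<omega> else 0)"
      using that by (intro sum.cong) (auto simp: E_def indicator_def)
    moreover have "i \<omega> \<in> {1..n}" using measurable_space[OF i that] by simp
    ultimately show ?thesis by simp
  qed
  have "integrable M (\<lambda>\<omega>. \<Sum>j=1..n. indicator (E j) \<omega> * h j \<omega>)"
    using part(1) by (intro Bochner_Integration.integrable_sum) auto
  then show "integrable M (\<lambda>\<omega>. h (i \<omega>) \<omega>)"
    by (subst Bochner_Integration.integrable_cong[OF refl eq]) auto
  have "(\<integral>\<omega>. h (i \<omega>) \<omega> \<partial>M) = (\<integral>\<omega>. (\<Sum>j=1..n. indicator (E j) \<omega> * h j \<omega>) \<partial>M)"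
    by (intro Bochner_Integration.integral_cong eq) auto
  also have "\<dots> = (\<Sum>j=1..n. (1 / real n) * (\<integral>\<omega>. h j \<omega> \<partial>M))"
    using part by (subst Bochner_Integration.integral_sum) auto
  also have "\<dots> = (\<integral>\<omega>. (1 / real n) * (\<Sum>j=1..n. h j \<omega>) \<partial>M)"
    using h_int by (simp add: Bochner_Integration.integral_sum sum_distrib_left)
  finally show "(\<integral>\<omega>. h (i \<omega>) \<omega> \<partial>M) = (\<integral>\<omega>. (1 / real n) * (\<Sum>j=1..n. h j \<omega>) \<partial>M)" .
qed

text \<open>The pointwise proximal inequality is integrated with \<open>z\<close> an almost nearest
  minimizer chosen as a function of \<open>x\<close>, hence known to \<open>G\<close>: the term in
  \<open>e\<close> has mean 0 and the index averages out. Truncation supplies integrability, and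
  \<open>\<epsilon>\<close> tends to 0 at the end.\<close>

lemma (in prob_space) expected_prox_step:
  fixes f :: "nat \<Rightarrow> 'b::{real_inner,banach,second_countable_topology} \<Rightarrow> real"
    and x e p :: "'a \<Rightarrow> 'b" and F :: "'b \<Rightarrow> real"
  assumes sub: "subalgebra M G"
    and i: "i \<in> measurable M (count_space {1..n})"
    and unif: "distr M (count_space {1..n}) i = uniform_count_measure {1..n}"
    and indep: "indep_set (sets (vimage_algebra (space M) i (count_space {1..n}))) (sets G)"
    and F: "F = (\<lambda>y. (1 / real n) * (\<Sum>j=1..n. f j y))" and ne: "argmin F \<noteq> {}"
    and cvx: "\<And>j. j \<in> {1..n} \<Longrightarrow> convex_on UNIV (f j)"
    and diff: "\<And>j y. j \<in> {1..n} \<Longrightarrow> f j differentiable (at y)"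
    and \<alpha>: "0 < \<alpha>"
    and x: "x \<in> borel_measurable G" and e: "has_cond_exp M G e (\<lambda>_. 0)"
    and p: "p \<in> borel_measurable M"
    and p_eq: "\<And>\<omega>. \<omega> \<in> space M \<Longrightarrow> p \<omega> = prox (\<lambda>y. \<alpha> * f (i \<omega>) y) (x \<omega> + \<alpha> *\<^sub>R e \<omega>)"
    and v: "(\<lambda>\<omega>. gradient (f (i \<omega>)) (x \<omega>) - e \<omega>) \<in> borel_measurable M"
  shows "(\<integral>\<^sup>+\<omega>. ennreal ((infdist (p \<omega>) (argmin F))\<^sup>2) \<partial>M)
      + ennreal (2 * \<alpha>) * (\<integral>\<^sup>+\<omega>. ennreal (F (x \<omega>) - (INF z. F z)) \<partial>M)
    \<le> (\<integral>\<^sup>+\<omega>. ennreal ((infdist (x \<omega>) (argmin F))\<^sup>2) \<partial>M)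
      + ennreal (\<alpha>\<^sup>2) * (\<integral>\<^sup>+\<omega>. ennreal ((norm (gradient (f (i \<omega>)) (x \<omega>) - e \<omega>))\<^sup>2) \<partial>M)"
proof -
  define S where "S = argmin F"
  define m where "m = (INF z. F z)"
  define v where "v = (\<lambda>\<omega>. gradient (f (i \<omega>)) (x \<omega>) - e \<omega>)"
  have [measurable]: "v \<in> borel_measurable M" unfolding v_def by fact
  note [measurable] = p measurable_from_subalg[OF sub x]
  have F_S: "F z = m" if "z \<in> S" for z
    using INF_eq_argmin[of z F] that by (simp add: m_def S_def)
  have m_le: "m \<le> F y" for y
  proof -
    obtain z where "z \<in> S" using ne by (auto simp: S_def)
    with F_S[of z] show ?thesis by (auto simp: S_def mem_argmin_iff)
  qed
  have f_meas [measurable]: "f j \<in> borel_measurable borel" if "j \<in> {1..n}" for j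
    using diff[OF that]
    by (intro borel_measurable_continuous_onI)
      (simp add: continuous_on_eq_continuous_at differentiable_imp_continuous_within)
  have [measurable]: "F \<in> borel_measurable borel" unfolding F
    by (intro borel_measurable_times borel_measurable_const borel_measurable_sum f_meas)
  have [measurable]: "(\<lambda>y. infdist y S) \<in> borel_measurable borel"
    by (intro borel_measurable_continuous_onI continuous_intros)
  have e_int: "integrable M e" and e_mean: "\<And>A. A \<in> sets G \<Longrightarrow> (LINT \<omega>:A|M. e \<omega>) = 0"
    using e by (auto simp: has_cond_exp_def)
  define U where "U = (\<lambda>\<omega>. (infdist (p \<omega>) S)\<^sup>2 + 2 * \<alpha> * (F (x \<omega>) - m))"
  have U_nonneg: "0 \<le> U \<omega>" for \<omega> using m_le \<alpha> by (simp add: U_def)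
  have [measurable]: "U \<in> borel_measurable M" unfolding U_def by measurable
  define I where "I = (\<integral>\<^sup>+\<omega>. ennreal ((infdist (x \<omega>) S)\<^sup>2) \<partial>M)"
  define N where "N = (\<integral>\<^sup>+\<omega>. ennreal ((norm (v \<omega>))\<^sup>2) \<partial>M)"
  have main: "(\<integral>\<^sup>+\<omega>. ennreal (U \<omega>) \<partial>M) \<le> (I + ennreal (\<alpha>\<^sup>2) * N) + ennreal \<epsilon>"
    if \<epsilon>: "0 < \<epsilon>" and N_fin: "N < \<infinity>" for \<epsilon>
  proof -
    have v_int: "integrable M (\<lambda>\<omega>. (norm (v \<omega>))\<^sup>2)"
      using N_fin by (intro integrableI_bounded) (auto simp: N_def)
    have N_eq: "N = ennreal (\<integral>\<omega>. (norm (v \<omega>))\<^sup>2 \<partial>M)"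
      unfolding N_def by (rule nn_integral_eq_integral[OF v_int]) simp
    obtain \<pi> where \<pi> [measurable]: "\<pi> \<in> borel_measurable borel" and \<pi>_S: "\<And>y. \<pi> y \<in> S"
      and \<pi>_le: "\<And>y. (dist y (\<pi> y))\<^sup>2 \<le> (infdist y S)\<^sup>2 + \<epsilon>"
      using measurable_approx_projection ne \<epsilon> unfolding S_def by blast
    define z where "z = (\<lambda>\<omega>. \<pi> (x \<omega>))"
    \<comment> \<open>\<open>h\<close> dominates everything that has to be truncated and is
      \<open>G\<close>-measurable, so its sublevel sets lie in \<open>G\<close> and respect the
      conditional mean and the independence.\<close>
    define h where "h = (\<lambda>\<omega>. norm (x \<omega> - z \<omega>) + (\<Sum>j=1..n. \<bar>f j (x \<omega>) - f j (z \<omega>)\<bar>))"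
    note x [measurable]
    have h_meas [measurable]: "h \<in> borel_measurable G"
      unfolding h_def z_def by measurable
    have h_bounds: "norm (x \<omega> - z \<omega>) \<le> h \<omega>" "j \<in> {1..n} \<Longrightarrow> \<bar>f j (x \<omega>) - f j (z \<omega>)\<bar> \<le> h \<omega>" for \<omega> j
      unfolding h_def
      using member_le_sum[of j "{1..n}" "\<lambda>j. \<bar>f j (x \<omega>) - f j (z \<omega>)\<bar>"]
      by (auto simp: sum_nonneg intro: add_increasing)
    \<comment> \<open>Neither \<open>e \<bullet> (x - z)\<close> nor \<open>f i x - f i z\<close> is known to be integrable; on \<open>A k\<close> both are.\<close>
    define A where "A = (\<lambda>k::nat. {\<omega>\<in>space G. h \<omega> \<le> real k})"
    have A_G [measurable]: "A k \<in> sets G" for k unfolding A_def by measurable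
    have A_M [measurable]: "A k \<in> sets M" for k using A_G sub by (auto simp: subalgebra_def)
    have trunc: "(\<integral>\<^sup>+\<omega>. ennreal (indicator (A k) \<omega> * U \<omega>) \<partial>M) \<le> (I + ennreal (\<alpha>\<^sup>2) * N) + ennreal \<epsilon>" for k
    proof -
      let ?i = "indicator (A k) :: 'a \<Rightarrow> real"
      have in_A: "h \<omega> \<le> real k" if "?i \<omega> \<noteq> 0" for \<omega> using that by (auto simp: A_def indicator_def)
      define Y where "Y = (\<lambda>\<omega>. ?i \<omega> *\<^sub>R (x \<omega> - z \<omega>))"
      have Y: "Y \<in> borel_measurable G" unfolding Y_def z_def by measurable
      have Y_bd: "norm (Y \<omega>) \<le> real k" for \<omega>
        using h_bounds(1)[of \<omega>] in_A[of \<omega>] by (auto simp: Y_def indicator_def)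
      note e_Y = integral_inner_eq_0_if_cond_mean_0[OF sub e_int e_mean Y Y_bd]
      define H where "H = (\<lambda>j \<omega>. ?i \<omega> * (f j (x \<omega>) - f j (z \<omega>)))"
      have H: "H j \<in> borel_measurable G" if "j \<in> {1..n}" for j
        using f_meas[OF that] unfolding H_def z_def by measurable
      have H_bd: "\<bar>H j \<omega>\<bar> \<le> real k" if "j \<in> {1..n}" for j \<omega>
        using h_bounds(2)[OF that, of \<omega>] in_A[of \<omega>] by (auto simp: H_def indicator_def)
      note H_i = uniform_index_average[OF sub i unif indep, of H "real k", OF H H_bd]
      have H_avg: "(1 / real n) * (\<Sum>j=1..n. H j \<omega>) = ?i \<omega> * (F (x \<omega>) - m)" for \<omega>
      proof -
        have "(1 / real n) * (\<Sum>j=1..n. H j \<omega>) = ?i \<omega> * (F (x \<omega>) - F (z \<omega>))"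
          by (simp add: F H_def sum_subtractf right_diff_distrib diff_divide_distrib flip: sum_distrib_left)
        then show ?thesis by (simp add: F_S z_def \<pi>_S)
      qed
      have gap_int: "integrable M (\<lambda>\<omega>. ?i \<omega> * (F (x \<omega>) - m))"
      proof -
        have "integrable M (H j)" if "j \<in> {1..n}" for j
          using measurable_from_subalg[OF sub H[OF that]] H_bd[OF that]
          by (intro integrable_const_bound[where B = "real k"]) auto
        then have "integrable M (\<lambda>\<omega>. (1 / real n) * (\<Sum>j=1..n. H j \<omega>))"
          by (intro integrable_mult_right Bochner_Integration.integrable_sum)
        then show ?thesis unfolding H_avg .
      qed
      have d_int: "integrable M (\<lambda>\<omega>. ?i \<omega> * (infdist (x \<omega>) S)\<^sup>2)"
      proof (rule integrable_const_bound[where B = "(real k)\<^sup>2"])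
        show "AE \<omega> in M. norm (?i \<omega> * (infdist (x \<omega>) S)\<^sup>2) \<le> (real k)\<^sup>2"
        proof (rule AE_I2)
          fix \<omega>
          have "infdist (x \<omega>) S \<le> norm (x \<omega> - z \<omega>)"
            using infdist_le[OF \<pi>_S, of "x \<omega>"] by (simp add: z_def dist_norm)
          then show "norm (?i \<omega> * (infdist (x \<omega>) S)\<^sup>2) \<le> (real k)\<^sup>2"
            using h_bounds(1)[of \<omega>] in_A[of \<omega>]
            by (auto simp: indicator_def intro!: power_mono infdist_nonneg)
        qed
      qed measurable
      \<comment> \<open>On \<open>A k\<close> this is the upper bound for the squared distance of
        \<open>p\<close>, with the index term moved to the right. Off \<open>A k\<close> it reduces
        to \<open>\<epsilon> + \<alpha>\<^sup>2 * (norm (v \<omega>))\<^sup>2\<close>, so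
        \<open>pw\<close> holds there as well.\<close>
      define W where "W = (\<lambda>\<omega>. ?i \<omega> * (infdist (x \<omega>) S)\<^sup>2 + \<epsilon> + \<alpha>\<^sup>2 * (norm (v \<omega>))\<^sup>2
        + 2 * \<alpha> * (e \<omega> \<bullet> Y \<omega>) - 2 * \<alpha> * H (i \<omega>) \<omega>)"
      define J where "J = (\<integral>\<omega>. ?i \<omega> * (infdist (x \<omega>) S)\<^sup>2 \<partial>M) + \<epsilon>
        + \<alpha>\<^sup>2 * (\<integral>\<omega>. (norm (v \<omega>))\<^sup>2 \<partial>M)"
      have "has_bochner_integral M (\<lambda>\<omega>. H (i \<omega>) \<omega>) (\<integral>\<omega>. ?i \<omega> * (F (x \<omega>) - m) \<partial>M)"
        using H_i(1) H_i(2)[unfolded H_avg] unfolding has_bochner_integral_iff by blast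
      moreover have "has_bochner_integral M (\<lambda>\<omega>. e \<omega> \<bullet> Y \<omega>) 0"
        using e_Y unfolding has_bochner_integral_iff by blast
      moreover have "has_bochner_integral M (\<lambda>\<omega>. \<epsilon>) \<epsilon>"
        by (simp add: has_bochner_integral_iff prob_space)
      ultimately have "has_bochner_integral M W
        (J + 2 * \<alpha> * 0 - 2 * \<alpha> * (\<integral>\<omega>. ?i \<omega> * (F (x \<omega>) - m) \<partial>M))"
        unfolding W_def J_def
        by (intro has_bochner_integral_add has_bochner_integral_diff has_bochner_integral_mult_right
            has_bochner_integral_integrable d_int v_int)
      then have W_int: "integrable M W"
        and W_eq: "(\<integral>\<omega>. W \<omega> \<partial>M) = J - 2 * \<alpha> * (\<integral>\<omega>. ?i \<omega> * (F (x \<omega>) - m) \<partial>M)"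
        by (simp_all add: has_bochner_integral_iff)
      have pw: "?i \<omega> * (infdist (p \<omega>) S)\<^sup>2 \<le> W \<omega>" if \<omega>: "\<omega> \<in> space M" for \<omega>
      proof -
        have iw: "i \<omega> \<in> {1..n}" using measurable_space[OF i \<omega>] by simp
        have "(infdist (p \<omega>) S)\<^sup>2 \<le> (dist (p \<omega>) (z \<omega>))\<^sup>2"
          by (intro power_mono infdist_le infdist_nonneg) (simp add: z_def \<pi>_S)
        then have "(infdist (p \<omega>) S)\<^sup>2 + 2 * \<alpha> * (f (i \<omega>) (x \<omega>) - f (i \<omega>) (z \<omega>))
          \<le> (infdist (x \<omega>) S)\<^sup>2 + \<epsilon> + \<alpha>\<^sup>2 * (norm (v \<omega>))\<^sup>2 + 2 * \<alpha> * (e \<omega> \<bullet> (x \<omega> - z \<omega>))"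
          using prox_step_ineq[OF cvx[OF iw] diff[OF iw] less_imp_le[OF \<alpha>], of "x \<omega>" "e \<omega>" "z \<omega>"] \<pi>_le[of "x \<omega>"]
          by (simp add: p_eq[OF \<omega>] v_def z_def)
        then show ?thesis
          using \<epsilon> by (cases "\<omega> \<in> A k") (auto simp: W_def Y_def H_def)
      qed
      \<comment> \<open>The truncation bounds \<open>x\<close> but not the next iterate
        \<open>p\<close>; integrability comes from domination by \<open>W\<close>.\<close>
      have p_int: "integrable M (\<lambda>\<omega>. ?i \<omega> * (infdist (p \<omega>) S)\<^sup>2)"
      proof (rule Bochner_Integration.integrable_bound[OF W_int])
        show "AE \<omega> in M. norm (?i \<omega> * (infdist (p \<omega>) S)\<^sup>2) \<le> norm (W \<omega>)"
          using pw by (intro AE_I2) (auto intro: order_trans[OF _ abs_ge_self])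
      qed measurable
      have "(\<integral>\<omega>. ?i \<omega> * (infdist (p \<omega>) S)\<^sup>2 \<partial>M) \<le> (\<integral>\<omega>. W \<omega> \<partial>M)"
        by (rule integral_mono[OF p_int W_int pw])
      moreover have iU: "?i \<omega> * U \<omega> = ?i \<omega> * (infdist (p \<omega>) S)\<^sup>2 + 2 * \<alpha> * (?i \<omega> * (F (x \<omega>) - m))" for \<omega>
        by (simp add: U_def algebra_simps)
      have iU_int: "integrable M (\<lambda>\<omega>. ?i \<omega> * U \<omega>)"
        unfolding iU by (intro Bochner_Integration.integrable_add integrable_mult_right p_int gap_int)
      have "(\<integral>\<omega>. ?i \<omega> * U \<omega> \<partial>M)
        = (\<integral>\<omega>. ?i \<omega> * (infdist (p \<omega>) S)\<^sup>2 \<partial>M) + 2 * \<alpha> * (\<integral>\<omega>. ?i \<omega> * (F (x \<omega>) - m) \<partial>M)"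
        unfolding iU using p_int gap_int by simp
      ultimately have "(\<integral>\<omega>. ?i \<omega> * U \<omega> \<partial>M)
        \<le> (\<integral>\<omega>. ?i \<omega> * (infdist (x \<omega>) S)\<^sup>2 \<partial>M) + \<epsilon> + \<alpha>\<^sup>2 * (\<integral>\<omega>. (norm (v \<omega>))\<^sup>2 \<partial>M)"
        unfolding W_eq J_def by simp
      then have "ennreal (\<integral>\<omega>. ?i \<omega> * U \<omega> \<partial>M)
        \<le> ennreal ((\<integral>\<omega>. ?i \<omega> * (infdist (x \<omega>) S)\<^sup>2 \<partial>M) + \<epsilon> + \<alpha>\<^sup>2 * (\<integral>\<omega>. (norm (v \<omega>))\<^sup>2 \<partial>M))"
        by (rule ennreal_leI)
      also have "\<dots> = ennreal (\<integral>\<omega>. ?i \<omega> * (infdist (x \<omega>) S)\<^sup>2 \<partial>M) + ennreal \<epsilon> + ennreal (\<alpha>\<^sup>2) * N"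
        using \<epsilon> by (simp add: N_eq ennreal_plus ennreal_mult)
      also have "ennreal (\<integral>\<omega>. ?i \<omega> * (infdist (x \<omega>) S)\<^sup>2 \<partial>M) = (\<integral>\<^sup>+\<omega>. ennreal (?i \<omega> * (infdist (x \<omega>) S)\<^sup>2) \<partial>M)"
        by (rule nn_integral_eq_integral[symmetric, OF d_int]) simp
      also have "\<dots> \<le> I"
        unfolding I_def by (intro nn_integral_mono ennreal_leI) (auto simp: indicator_def)
      finally have "ennreal (\<integral>\<omega>. ?i \<omega> * U \<omega> \<partial>M) \<le> I + ennreal \<epsilon> + ennreal (\<alpha>\<^sup>2) * N"
        by (simp add: add_mono)
      moreover have "(\<integral>\<^sup>+\<omega>. ennreal (?i \<omega> * U \<omega>) \<partial>M) = ennreal (\<integral>\<omega>. ?i \<omega> * U \<omega> \<partial>M)"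
        by (rule nn_integral_eq_integral[OF iU_int]) (simp add: U_nonneg)
      ultimately show ?thesis by (simp add: ac_simps)
    qed
    \<comment> \<open>The events \<open>A k\<close> increase to the whole space, and monotone
      convergence removes the truncation.\<close>
    have "(\<integral>\<^sup>+\<omega>. ennreal (U \<omega>) \<partial>M) \<le> (\<integral>\<^sup>+\<omega>. (SUP k. ennreal (indicator (A k) \<omega> * U \<omega>)) \<partial>M)"
    proof (rule nn_integral_mono)
      fix \<omega> assume "\<omega> \<in> space M"
      obtain k :: nat where "h \<omega> \<le> real k" using real_arch_simple by blast
      then have "\<omega> \<in> A k" using \<open>\<omega> \<in> space M\<close> sub by (simp add: A_def subalgebra_def)
      then show "ennreal (U \<omega>) \<le> (SUP k. ennreal (indicator (A k) \<omega> * U \<omega>))"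
        by (intro SUP_upper2[of k]) auto
    qed
    also have "\<dots> = (SUP k. \<integral>\<^sup>+\<omega>. ennreal (indicator (A k) \<omega> * U \<omega>) \<partial>M)"
    proof (rule nn_integral_monotone_convergence_SUP)
      show "incseq (\<lambda>k \<omega>. ennreal (indicator (A k) \<omega> * U \<omega>))"
        by (auto simp: incseq_def le_fun_def A_def indicator_def U_nonneg intro!: ennreal_leI)
    qed measurable
    also have "\<dots> \<le> (I + ennreal (\<alpha>\<^sup>2) * N) + ennreal \<epsilon>"
      using trunc by (intro SUP_least)
    finally show ?thesis .
  qed
  have "(\<integral>\<^sup>+\<omega>. ennreal (U \<omega>) \<partial>M) \<le> I + ennreal (\<alpha>\<^sup>2) * N"
  proof (cases "N < \<infinity>")
    case True
    show ?thesis by (rule ennreal_le_epsilon) (rule main[OF _ True])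
  next
    case False
    then have "N = \<infinity>" by (simp add: not_less top_unique)
    then have "ennreal (\<alpha>\<^sup>2) * N = \<infinity>" using \<alpha> by (simp add: ennreal_mult_top)
    then show ?thesis by simp
  qed
  moreover have "(\<integral>\<^sup>+\<omega>. ennreal (U \<omega>) \<partial>M) = (\<integral>\<^sup>+\<omega>. ennreal ((infdist (p \<omega>) S)\<^sup>2) \<partial>M)
      + ennreal (2 * \<alpha>) * (\<integral>\<^sup>+\<omega>. ennreal (F (x \<omega>) - m) \<partial>M)"
  proof -
    have "(\<integral>\<^sup>+\<omega>. ennreal (U \<omega>) \<partial>M)
      = (\<integral>\<^sup>+\<omega>. ennreal ((infdist (p \<omega>) S)\<^sup>2) + ennreal (2 * \<alpha>) * ennreal (F (x \<omega>) - m) \<partial>M)"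
    proof (rule nn_integral_cong)
      fix \<omega>
      have "0 \<le> 2 * \<alpha>" "0 \<le> F (x \<omega>) - m" using m_le \<alpha> by simp_all
      then show "ennreal (U \<omega>)
        = ennreal ((infdist (p \<omega>) S)\<^sup>2) + ennreal (2 * \<alpha>) * ennreal (F (x \<omega>) - m)"
        unfolding U_def by (subst ennreal_mult[symmetric]) (auto intro!: ennreal_plus)
    qed
    then show ?thesis by (simp add: nn_integral_add nn_integral_cmult)
  qed
  ultimately show ?thesis by (simp add: S_def m_def I_def N_def v_def)
qed

text \<open>As \<open>e\<close> has mean 0 and the index is uniform, the mean of \<open>v\<close> is
  \<open>g = gradient F y\<close>. Jensen's inequality for the squared norm appears as the integral
  of \<open>2 * (v \<bullet> g) \<le> (norm v)\<^sup>2 + g \<bullet> g\<close>. The result serves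
  the positivity of \<open>q\<close>.\<close>

lemma (in prob_space) norm_gradient_sq_le_second_moment:
  fixes f :: "nat \<Rightarrow> 'b::{real_inner,banach,second_countable_topology} \<Rightarrow> real"
    and e :: "'a \<Rightarrow> 'b" and F :: "'b \<Rightarrow> real"
  assumes sub: "subalgebra M G"
    and i: "i \<in> measurable M (count_space {1..n})"
    and unif: "distr M (count_space {1..n}) i = uniform_count_measure {1..n}"
    and indep: "indep_set (sets (vimage_algebra (space M) i (count_space {1..n}))) (sets G)"
    and F: "F = (\<lambda>y. (1 / real n) * (\<Sum>j=1..n. f j y))"
    and diff: "\<And>j y. j \<in> {1..n} \<Longrightarrow> f j differentiable (at y)"
    and e: "has_cond_exp M G e (\<lambda>_. 0)"
    and v: "(\<lambda>\<omega>. gradient (f (i \<omega>)) y - e \<omega>) \<in> borel_measurable M"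
    and K: "0 \<le> K" "(\<integral>\<^sup>+\<omega>. ennreal ((norm (gradient (f (i \<omega>)) y - e \<omega>))\<^sup>2) \<partial>M) \<le> ennreal K"
  shows "(norm (gradient F y))\<^sup>2 \<le> K"
proof -
  define g where "g = gradient F y"
  define v where "v = (\<lambda>\<omega>. gradient (f (i \<omega>)) y - e \<omega>)"
  define h where "h = (\<lambda>j (\<omega>::'a). gradient (f j) y \<bullet> g)"
  have [measurable]: "v \<in> borel_measurable M" unfolding v_def by fact
  have g: "g = (1 / real n) *\<^sub>R (\<Sum>j=1..n. gradient (f j) y)"
    unfolding g_def F by (intro gradient_eqI GDERIV_average diff)
  have g_eq: "g \<bullet> g = (1 / real n) * (\<Sum>j=1..n. h j \<omega>)" for \<omega>
    unfolding h_def inner_sum_left[symmetric] inner_scaleR_left[symmetric] g[symmetric] ..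
  have h_bd: "\<bar>h j \<omega>\<bar> \<le> (\<Sum>j=1..n. \<bar>gradient (f j) y \<bullet> g\<bar>)" if "j \<in> {1..n}" for j \<omega>
    unfolding h_def using that by (intro member_le_sum) auto
  have h_G: "h j \<in> borel_measurable G" for j by (simp add: h_def)
  note h_i = uniform_index_average[OF sub i unif indep,
      of h "\<Sum>j=1..n. \<bar>gradient (f j) y \<bullet> g\<bar>", OF h_G h_bd]
  have e_int: "integrable M e" and e_mean: "\<And>A. A \<in> sets G \<Longrightarrow> (LINT \<omega>:A|M. e \<omega>) = 0"
    using e by (auto simp: has_cond_exp_def)
  note e_g = integral_inner_eq_0_if_cond_mean_0[OF sub e_int e_mean, of "\<lambda>_. g" "norm g"]
  have v_g: "v \<omega> \<bullet> g = h (i \<omega>) \<omega> - e \<omega> \<bullet> g" for \<omega>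
    by (simp add: v_def h_def inner_diff_left)
  have int: "integrable M (\<lambda>\<omega>. v \<omega> \<bullet> g)" and "(\<integral>\<omega>. v \<omega> \<bullet> g \<partial>M) = g \<bullet> g"
    unfolding v_g using h_i(1) h_i(2)[folded g_eq] e_g by (simp_all add: prob_space)
  have v_fin: "(\<integral>\<^sup>+\<omega>. ennreal ((norm (v \<omega>))\<^sup>2) \<partial>M) \<le> ennreal K" using K by (simp add: v_def)
  then have v_int: "integrable M (\<lambda>\<omega>. (norm (v \<omega>))\<^sup>2)"
    by (intro integrableI_bounded) (auto intro: le_less_trans)
  have "2 * (v \<omega> \<bullet> g) \<le> (norm (v \<omega>))\<^sup>2 + g \<bullet> g" for \<omega>
    using inner_ge_zero[of "v \<omega> - g"]
    by (simp add: power2_norm_eq_inner inner_diff_left inner_diff_right inner_commute)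
  then have "(\<integral>\<omega>. 2 * (v \<omega> \<bullet> g) \<partial>M) \<le> (\<integral>\<omega>. (norm (v \<omega>))\<^sup>2 + g \<bullet> g \<partial>M)"
    using int v_int by (intro integral_mono) auto
  then have "g \<bullet> g \<le> (\<integral>\<omega>. (norm (v \<omega>))\<^sup>2 \<partial>M)"
    using v_int \<open>(\<integral>\<omega>. v \<omega> \<bullet> g \<partial>M) = g \<bullet> g\<close> by (simp add: prob_space)
  also have "\<dots> \<le> K"
    using v_fin K(1) nn_integral_eq_integral[OF v_int] by (simp add: ennreal_le_iff)
  finally show ?thesis by (simp add: g_def power2_norm_eq_inner)
qed

section \<open>The Lyapunov recursion for extended nonnegative quantities\<close>

lemma lyapunov_step_finite:
  fixes a a' s s' g v :: ennreal
  assumes nonneg: "0 \<le> A" "0 \<le> B" "0 \<le> C" "\<rho> \<le> 1" "0 < M" "0 < \<alpha>" "0 < \<mu>" "0 \<le> q"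
    and \<alpha>_le: "\<alpha> * (A + M * C) \<le> 1"
    and q1: "1 - \<alpha> * \<mu> * (1 - \<alpha> * (A + M * C)) \<le> q" and q2: "1 + B / M - \<rho> \<le> q"
    and step: "a' + ennreal (2 * \<alpha>) * g \<le> a + ennreal (\<alpha>\<^sup>2) * v"
    and var: "v \<le> ennreal (2 * A) * g + ennreal B * s"
    and rec: "s' \<le> ennreal (1 - \<rho>) * s + ennreal (2 * C) * g"
    and upper: "g \<le> ennreal (L / 2) * a" and lower: "ennreal (\<mu> / 2) * a \<le> g"
    and fin: "a < \<infinity>" "s < \<infinity>"
  shows "a' + ennreal (\<alpha>\<^sup>2 * M) * s' \<le> ennreal q * (a + ennreal (\<alpha>\<^sup>2 * M) * s)"
proof -
  note top_simps = ennreal_mult_eq_top_iff less_top[symmetric]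
  \<comment> \<open>Finiteness of \<open>a\<close> and \<open>s\<close> spreads to all other
    quantities; the argument then takes place in the reals, where terms can be subtracted.\<close>
  have g_fin: "g < \<infinity>" using fin by (intro le_less_trans[OF upper]) (simp add: top_simps)
  have v_fin: "v < \<infinity>" using fin g_fin by (intro le_less_trans[OF var]) (simp add: top_simps)
  have s'_fin: "s' < \<infinity>" using fin g_fin by (intro le_less_trans[OF rec]) (simp add: top_simps)
  have "a' + ennreal (2 * \<alpha>) * g < \<infinity>"
    using fin v_fin by (intro le_less_trans[OF step]) (simp add: top_simps)
  then have a'_fin: "a' < \<infinity>" by (auto simp: top_simps)
  obtain ar where a: "a = ennreal ar" "0 \<le> ar" using fin by (cases a) auto
  obtain ar' where a': "a' = ennreal ar'" "0 \<le> ar'" using a'_fin by (cases a') auto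
  obtain sr where s: "s = ennreal sr" "0 \<le> sr" using fin by (cases s) auto
  obtain sr' where s': "s' = ennreal sr'" "0 \<le> sr'" using s'_fin by (cases s') auto
  obtain gr where g: "g = ennreal gr" "0 \<le> gr" using g_fin by (cases g) auto
  obtain vr where v: "v = ennreal vr" "0 \<le> vr" using v_fin by (cases v) auto
  note pos = \<open>0 \<le> A\<close> \<open>0 \<le> B\<close> \<open>0 \<le> C\<close> \<open>\<rho> \<le> 1\<close> \<open>0 < \<alpha>\<close> \<open>0 < \<mu>\<close>
    \<open>0 \<le> ar\<close> \<open>0 \<le> ar'\<close> \<open>0 \<le> sr\<close> \<open>0 \<le> sr'\<close> \<open>0 \<le> gr\<close> \<open>0 \<le> vr\<close>
  have "ennreal (ar' + 2 * \<alpha> * gr) \<le> ennreal (ar + \<alpha>\<^sup>2 * vr)"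
    using step pos by (simp add: a a' g v ennreal_mult)
  then have 1: "ar' + 2 * \<alpha> * gr \<le> ar + \<alpha>\<^sup>2 * vr"
    using pos by (subst (asm) ennreal_le_iff) auto
  have "ennreal vr \<le> ennreal (2 * A * gr + B * sr)"
    using var pos by (simp add: s g v ennreal_mult)
  then have 2: "vr \<le> 2 * A * gr + B * sr"
    using pos by (subst (asm) ennreal_le_iff) auto
  have "ennreal sr' \<le> ennreal ((1 - \<rho>) * sr + 2 * C * gr)"
    using rec pos by (simp add: s s' g ennreal_mult)
  then have 3: "sr' \<le> (1 - \<rho>) * sr + 2 * C * gr"
    using pos by (subst (asm) ennreal_le_iff) auto
  have "ennreal (\<mu> / 2 * ar) \<le> ennreal gr"
    using lower pos unfolding a g by (subst ennreal_mult) auto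
  then have 4: "\<mu> / 2 * ar \<le> gr"
    using pos by (subst (asm) ennreal_le_iff) auto
  have v_bd: "\<alpha>\<^sup>2 * vr \<le> \<alpha>\<^sup>2 * (2 * A * gr + B * sr)" using 2 by (intro mult_left_mono) auto
  have s_bd: "\<alpha>\<^sup>2 * M * sr' \<le> \<alpha>\<^sup>2 * M * ((1 - \<rho>) * sr + 2 * C * gr)"
    using 3 \<open>0 < M\<close> by (intro mult_left_mono) auto
  have q_s: "\<alpha>\<^sup>2 * M * ((1 + B / M - \<rho>) * sr) \<le> \<alpha>\<^sup>2 * M * (q * sr)"
    using q2 s \<open>0 < M\<close> by (intro mult_left_mono mult_right_mono) auto
  \<comment> \<open>With the weight \<open>\<alpha>\<^sup>2 * M\<close>, the decay of
    \<open>s\<close> and the noise contribution \<open>\<alpha>\<^sup>2 * B * s\<close> combine into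
    the factor \<open>1 + B / M - \<rho>\<close>, which \<open>q2\<close> bounds by
    \<open>q\<close>.\<close>
  have q_s': "\<alpha>\<^sup>2 * M * ((1 + B / M - \<rho>) * sr) = \<alpha>\<^sup>2 * M * (1 - \<rho>) * sr + \<alpha>\<^sup>2 * B * sr"
    using \<open>0 < M\<close> by (simp add: field_simps)
  \<comment> \<open>By \<open>\<alpha>_le\<close> the gap enters the final estimate with a
    coefficient that is not positive, so its lower bound may replace it.\<close>
  have growth: "2 * \<alpha> * (1 - \<alpha> * (A + M * C)) * (\<mu> / 2 * ar) \<le> 2 * \<alpha> * (1 - \<alpha> * (A + M * C)) * gr"
    using 4 \<alpha>_le \<open>0 < \<alpha>\<close> by (intro mult_left_mono) auto
  have q_a: "(1 - \<alpha> * \<mu> * (1 - \<alpha> * (A + M * C))) * ar \<le> q * ar"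
    using q1 a by (intro mult_right_mono) auto
  have "ar' + \<alpha>\<^sup>2 * M * sr'
    \<le> ar - 2 * \<alpha> * gr + \<alpha>\<^sup>2 * (2 * A * gr + B * sr) + \<alpha>\<^sup>2 * M * ((1 - \<rho>) * sr + 2 * C * gr)"
    using 1 v_bd s_bd by linarith
  also have "\<dots> = ar - 2 * \<alpha> * (1 - \<alpha> * (A + M * C)) * gr + (\<alpha>\<^sup>2 * M * (1 - \<rho>) * sr + \<alpha>\<^sup>2 * B * sr)"
    by (simp add: algebra_simps power2_eq_square)
  also have "\<dots> \<le> ar - 2 * \<alpha> * (1 - \<alpha> * (A + M * C)) * (\<mu> / 2 * ar) + \<alpha>\<^sup>2 * M * (q * sr)"
    using growth q_s unfolding q_s' by linarith
  also have "\<dots> = (1 - \<alpha> * \<mu> * (1 - \<alpha> * (A + M * C))) * ar + \<alpha>\<^sup>2 * M * (q * sr)"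
    by (simp add: algebra_simps)
  also have "\<dots> \<le> q * ar + \<alpha>\<^sup>2 * M * (q * sr)" using q_a by linarith
  finally have "ar' + \<alpha>\<^sup>2 * M * sr' \<le> q * (ar + \<alpha>\<^sup>2 * M * sr)"
    by (simp add: algebra_simps)
  then have "ennreal (ar' + \<alpha>\<^sup>2 * M * sr') \<le> ennreal (q * (ar + \<alpha>\<^sup>2 * M * sr))"
    by (rule ennreal_leI)
  then show ?thesis
    using pos \<open>0 < M\<close> \<open>0 \<le> q\<close> by (simp add: a a' s s' ennreal_mult)
qed

text \<open>For \<open>q > 0\<close>, an infinite \<open>a\<close> or \<open>s\<close> makes the
  right-hand side infinite. The hypothesis \<open>cases\<close> guards \<open>q = 0\<close>, where 0
  times infinity is 0 and the finiteness of \<open>a\<close> has to be supplied.\<close>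

lemma lyapunov_step:
  fixes a a' s s' g v :: ennreal
  assumes nonneg: "0 \<le> A" "0 \<le> B" "0 \<le> C" "\<rho> \<le> 1" "0 < M" "0 < \<alpha>" "0 < \<mu>" "0 \<le> q"
    and \<alpha>_le: "\<alpha> * (A + M * C) \<le> 1"
    and q1: "1 - \<alpha> * \<mu> * (1 - \<alpha> * (A + M * C)) \<le> q" and q2: "1 + B / M - \<rho> \<le> q"
    and step: "a' + ennreal (2 * \<alpha>) * g \<le> a + ennreal (\<alpha>\<^sup>2) * v"
    and var: "v \<le> ennreal (2 * A) * g + ennreal B * s"
    and rec: "s' \<le> ennreal (1 - \<rho>) * s + ennreal (2 * C) * g"
    and upper: "g \<le> ennreal (L / 2) * a" and lower: "ennreal (\<mu> / 2) * a \<le> g"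
    and cases: "0 < q \<or> a < \<infinity>"
  shows "a' + ennreal (\<alpha>\<^sup>2 * M) * s' \<le> ennreal q * (a + ennreal (\<alpha>\<^sup>2 * M) * s)"
proof (cases "a < \<infinity> \<and> s < \<infinity>")
  case True
  then show ?thesis by (intro lyapunov_step_finite[OF assms(1-16)]) auto
next
  case infinite: False
  show ?thesis
  proof (cases "0 < q")
    case True
    then have "ennreal q * (a + ennreal (\<alpha>\<^sup>2 * M) * s) = \<infinity>"
      using infinite nonneg by (auto simp: ennreal_mult_eq_top_iff not_less top_unique)
    then show ?thesis by simp
  next
    case False
    txt \<open>Here \<open>ennreal q * \<infinity> = 0\<close>, but \<open>q = 0\<close> forces \<open>B = 0\<close> and \<open>\<rho> = 1\<close>, and then \<open>s\<close> is irrelevant.\<close>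
    have "0 \<le> B / M" using nonneg by simp
    with False nonneg q2 have "B / M = 0" "\<rho> = 1" by linarith+
    then have "B = 0" using nonneg by simp
    have "a' + ennreal (\<alpha>\<^sup>2 * M) * s' \<le> ennreal q * (a + ennreal (\<alpha>\<^sup>2 * M) * 0)"
      using var rec False cases \<open>B = 0\<close> \<open>\<rho> = 1\<close>
      by (intro lyapunov_step_finite[OF nonneg \<alpha>_le q1 q2 step _ _ upper lower]) auto
    also have "\<dots> \<le> ennreal q * (a + ennreal (\<alpha>\<^sup>2 * M) * s)"
      by (intro mult_left_mono add_left_mono) auto
    finally show ?thesis .
  qed
qed

section \<open>Linear convergence\<close>

theorem theorem3p3:
  fixes P :: "'w measure"
    and n :: nat
    and f :: "nat \<Rightarrow> 'a::{real_inner,banach,second_countable_topology} \<Rightarrow> real"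
    and F :: "'a \<Rightarrow> real"
    and x\<^sub>0 :: 'a
    and i :: "nat \<Rightarrow> 'w \<Rightarrow> nat"
    and e x :: "nat \<Rightarrow> 'w \<Rightarrow> 'a"
    and \<FF> :: "nat \<Rightarrow> 'w measure"
    and D :: "'w \<Rightarrow> real"
    and \<sigma> :: "nat \<Rightarrow> 'w \<Rightarrow> real"
    and L \<mu> \<alpha> A B C \<rho> M q :: real
    and V :: "nat \<Rightarrow> ennreal"
  assumes P: "prob_space P"
    and n: "n \<ge> 1"
    and F: "F = (\<lambda>y. (1 / real n) * (\<Sum>j=1..n. f j y))"
    and argmin_F: "argmin F \<noteq> {}"
    and L: "L > 0"
    and convex: "\<And>j. j \<in> {1..n} \<Longrightarrow> convex_on UNIV (f j)"
    and smooth: "\<And>j. j \<in> {1..n} \<Longrightarrow> smooth_with L (f j)"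
    and \<mu>: "\<mu> > 0"
    and PL: "polyak_lojasiewicz \<mu> F"
    and \<alpha>: "\<alpha> > 0"
    and algorithm: "generic_algorithm P n f \<alpha> x\<^sub>0 i e x"
    and constants: "A \<ge> 0" "B \<ge> 0" "C \<ge> 0" "\<rho> \<in> {0..1}" "\<rho> > 0"
    and D: "D \<in> borel_measurable P" "AE \<omega> in P. D \<omega> \<le> 0"
    and \<sigma>: "\<And>k. \<sigma> k \<in> borel_measurable P"
    and filtration: "adapted_filtration P n i x \<FF>"
    and variance: "variance_assumptions P f F i e x \<FF> A B C \<rho> D \<sigma>"
    and M: "M > 0" "M > B / \<rho>"
    and \<alpha>_less: "A + M * C \<noteq> 0 \<Longrightarrow> \<alpha> < 1 / (A + M * C)"
    and q: "q = max (1 - \<alpha> * \<mu> * (1 - \<alpha> * (A + M * C))) (1 + B / M - \<rho>)"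
    and V: "\<And>k. V k = (\<integral>\<^sup>+ \<omega>. ennreal ((infdist (x k \<omega>) (argmin F))\<^sup>2) \<partial>P)
                     + ennreal (\<alpha>\<^sup>2 * M) * (\<integral>\<^sup>+ \<omega>. ennreal ((\<sigma> k \<omega>)\<^sup>2) \<partial>P)"
  shows "0 \<le> q \<and> q < 1 \<and> (\<not> (x\<^sub>0 \<in> argmin F \<and> B = 0 \<and> \<rho> = 1) \<longrightarrow> 0 < q) \<and>
    (\<forall>k. V (Suc k) \<le> ennreal q * V k) \<and>
    (\<forall>k. (\<integral>\<^sup>+ \<omega>. ennreal ((infdist (x k \<omega>) (argmin F))\<^sup>2) \<partial>P)
       \<le> ennreal (q ^ k) *
          (ennreal ((infdist x\<^sub>0 (argmin F))\<^sup>2)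
           + ennreal (\<alpha>\<^sup>2 * M) * (\<integral>\<^sup>+ \<omega>. ennreal ((\<sigma> 0 \<omega>)\<^sup>2) \<partial>P))) \<and>
    (\<forall>k. (\<integral>\<^sup>+ \<omega>. ennreal (F (x k \<omega>) - (INF z. F z)) \<partial>P)
       \<le> ennreal (q ^ k * L / 2) *
          (ennreal ((infdist x\<^sub>0 (argmin F))\<^sup>2)
           + ennreal (\<alpha>\<^sup>2 * M) * (\<integral>\<^sup>+ \<omega>. ennreal ((\<sigma> 0 \<omega>)\<^sup>2) \<partial>P)))"
proof -
  interpret prob_space P by fact
  define S where "S = argmin F"
  define m where "m = (INF z. F z)"

  \<comment> \<open>Regularity of \<open>F\<close> and measurability\<close>
  have diff: "f j differentiable (at y)" if "j \<in> {1..n}" for j y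
    using smooth[OF that] by (simp add: smooth_with_def)
  have F_cvx: "convex_on UNIV F" unfolding F by (rule convex_on_average[OF convex])
  have F_smooth: "smooth_with L F" unfolding F by (rule smooth_with_average[OF n smooth])
  have sub: "subalgebra P (\<FF> k)" for k using filtration by (simp add: adapted_filtration_def)
  have x_FF: "x k \<in> borel_measurable (\<FF> k)" for k using filtration by (simp add: adapted_filtration_def)
  have x_meas [measurable]: "x k \<in> borel_measurable P" for k
    by (rule measurable_from_subalg[OF sub x_FF])
  have "i k \<in> measurable (\<FF> (Suc k)) (count_space {1..n})" for k
    using filtration by (simp add: adapted_filtration_def)
  then have i_meas: "i k \<in> measurable P (count_space {1..n})" for k
    by (rule measurable_from_subalg[OF sub])
  have indep: "indep_set (sets (vimage_algebra (space P) (i k) (count_space {1..n}))) (sets (\<FF> k))" for k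
    using filtration by (simp add: adapted_filtration_def)
  have e_meas [measurable]: "e k \<in> borel_measurable P" for k
    using algorithm by (simp add: generic_algorithm_def)
  have unif: "distr P (count_space {1..n}) (i k) = uniform_count_measure {1..n}" for k
    using algorithm by (simp add: generic_algorithm_def)
  have x_0: "x 0 \<omega> = x\<^sub>0" if "\<omega> \<in> space P" for \<omega>
    using algorithm that by (simp add: generic_algorithm_def)
  have x_Suc: "x (Suc k) \<omega> = prox (\<lambda>y. \<alpha> * f (i k \<omega>) y) (x k \<omega> + \<alpha> *\<^sub>R e k \<omega>)"
    if "\<omega> \<in> space P" for k \<omega>
    using algorithm that by (simp add: generic_algorithm_def)
  have e_mean: "has_cond_exp P (\<FF> k) (e k) (\<lambda>_. 0)" for k
    using variance by (simp add: variance_assumptions_def)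
  have F_meas [measurable]: "F \<in> borel_measurable borel"
    using F_smooth unfolding smooth_with_def
    by (intro borel_measurable_continuous_onI)
      (simp add: continuous_on_eq_continuous_at differentiable_imp_continuous_within)
  have m_le: "m \<le> F y" for y
  proof -
    obtain z where z: "z \<in> argmin F" using argmin_F by blast
    then show ?thesis using INF_eq_argmin[OF z] by (simp add: m_def mem_argmin_iff)
  qed
  have [measurable]: "(\<lambda>y. infdist y S) \<in> borel_measurable borel"
    by (intro borel_measurable_continuous_onI continuous_intros)
  have grad_meas: "gradient (f j) \<in> borel_measurable borel" if "j \<in> {1..n}" for j
  proof -
    have "L-lipschitz_on UNIV (gradient (f j))"
      using smooth[OF that] L by (auto simp: smooth_with_def dist_norm intro!: lipschitz_onI)
    then show ?thesis by (intro borel_measurable_continuous_onI lipschitz_on_continuous_on)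
  qed
  define v where "v = (\<lambda>k \<omega>. gradient (f (i k \<omega>)) (x k \<omega>) - e k \<omega>)"
  have v_meas: "v k \<in> borel_measurable P" for k
  proof -
    \<comment> \<open>The random index takes finitely many values, so it suffices to treat each
      fixed \<open>j\<close>.\<close>
    have "(\<lambda>\<omega>. gradient (f (i k \<omega>)) (x k \<omega>)) \<in> borel_measurable P"
    proof (rule measurable_compose_countable'[OF _ i_meas])
      fix j assume "j \<in> {1..n}"
      then show "(\<lambda>\<omega>. gradient (f j) (x k \<omega>)) \<in> borel_measurable P"
        by (rule measurable_compose[OF x_meas grad_meas])
    qed simp
    then show ?thesis unfolding v_def by measurable
  qed

  \<comment> \<open>Expected quantities and the inequalities between them\<close>
  define a where "a = (\<lambda>k. \<integral>\<^sup>+ \<omega>. ennreal ((infdist (x k \<omega>) S)\<^sup>2) \<partial>P)"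
  define s where "s = (\<lambda>k. \<integral>\<^sup>+ \<omega>. ennreal ((\<sigma> k \<omega>)\<^sup>2) \<partial>P)"
  define g where "g = (\<lambda>k. \<integral>\<^sup>+ \<omega>. ennreal (F (x k \<omega>) - m) \<partial>P)"
  define N where "N = (\<lambda>k. \<integral>\<^sup>+ \<omega>. ennreal ((norm (v k \<omega>))\<^sup>2) \<partial>P)"
  have step: "a (Suc k) + ennreal (2 * \<alpha>) * g k \<le> a k + ennreal (\<alpha>\<^sup>2) * N k" for k
    unfolding a_def g_def N_def v_def m_def S_def
    by (rule expected_prox_step[OF sub i_meas unif indep F argmin_F convex diff \<alpha> x_FF e_mean x_meas x_Suc
          v_meas[unfolded v_def]])
  have var: "N k \<le> ennreal (2 * A) * g k + ennreal B * s k" for k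
  proof -
    interpret finite_measure_subalgebra P "\<FF> k" by unfold_locales (rule sub)
    \<comment> \<open>The factor 1 brings \<open>N k\<close> into the form of the defining property
      of \<open>nn_cond_exp\<close>, which tests against a measurable function of the past.\<close>
    have "N k = (\<integral>\<^sup>+ \<omega>. 1 * nn_cond_exp P (\<FF> k) (\<lambda>\<omega>. ennreal ((norm (v k \<omega>))\<^sup>2)) \<omega> \<partial>P)"
      unfolding N_def using v_meas[of k] by (subst nn_cond_exp_intg) auto
    also have "\<dots> \<le> (\<integral>\<^sup>+ \<omega>. ennreal (2 * A) * ennreal (F (x k \<omega>) - m) + ennreal B * ennreal ((\<sigma> k \<omega>)\<^sup>2) \<partial>P)"
    proof (rule nn_integral_mono_AE)
      have "AE \<omega> in P. enn2ereal (nn_cond_exp P (\<FF> k) (\<lambda>\<omega>. ennreal ((norm (v k \<omega>))\<^sup>2)) \<omega>)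
          \<le> ereal (2 * A * (F (x k \<omega>) - m) + B * (\<sigma> k \<omega>)\<^sup>2 + D \<omega>)"
        using variance by (simp add: variance_assumptions_def v_def m_def)
      then show "AE \<omega> in P. 1 * nn_cond_exp P (\<FF> k) (\<lambda>\<omega>. ennreal ((norm (v k \<omega>))\<^sup>2)) \<omega>
          \<le> ennreal (2 * A) * ennreal (F (x k \<omega>) - m) + ennreal B * ennreal ((\<sigma> k \<omega>)\<^sup>2)"
        using D(2)
      proof eventually_elim
        case (elim \<omega>)
        define r where "r = 2 * A * (F (x k \<omega>) - m) + B * (\<sigma> k \<omega>)\<^sup>2"
        have pos: "0 \<le> 2 * A * (F (x k \<omega>) - m)" "0 \<le> B * (\<sigma> k \<omega>)\<^sup>2"
          using constants m_le[of "x k \<omega>"] by simp_all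
        \<comment> \<open>The term \<open>D \<omega>\<close> is dropped by its sign. The remaining
          bound \<open>r\<close> is nonnegative, so passing to \<open>ennreal\<close> does not
          truncate it.\<close>
        have "enn2ereal (nn_cond_exp P (\<FF> k) (\<lambda>\<omega>. ennreal ((norm (v k \<omega>))\<^sup>2)) \<omega>) \<le> ereal r"
          using elim by (intro order_trans[OF elim(1)]) (simp add: r_def)
        moreover have "0 \<le> r" using pos by (simp add: r_def)
        then have "ereal r = enn2ereal (ennreal r)" by (simp add: enn2ereal_ennreal)
        ultimately have "nn_cond_exp P (\<FF> k) (\<lambda>\<omega>. ennreal ((norm (v k \<omega>))\<^sup>2)) \<omega> \<le> ennreal r"
          by (simp add: less_eq_ennreal.rep_eq)
        moreover have "ennreal r = ennreal (2 * A) * ennreal (F (x k \<omega>) - m) + ennreal B * ennreal ((\<sigma> k \<omega>)\<^sup>2)"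
          unfolding r_def ennreal_plus[OF pos] using constants m_le[of "x k \<omega>"]
          by (subst (1 2) ennreal_mult) auto
        ultimately show ?case by simp
      qed
    qed
    also have "\<dots> = ennreal (2 * A) * g k + ennreal B * s k"
      unfolding g_def s_def using \<sigma> by (simp add: nn_integral_add nn_integral_cmult)
    finally show ?thesis .
  qed
  have rec: "s (Suc k) \<le> ennreal (1 - \<rho>) * s k + ennreal (2 * C) * g k" for k
    using variance by (simp add: variance_assumptions_def s_def g_def m_def)
  have upper: "g k \<le> ennreal (L / 2) * a k" for k
  proof -
    have "ennreal (F y - m) \<le> ennreal (L / 2) * ennreal ((infdist y S)\<^sup>2)" for y
      using smooth_quadratic_upper_bound[OF F_smooth L argmin_F, of y] L
      by (subst ennreal_mult[symmetric]) (auto simp: S_def m_def intro!: ennreal_leI)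
    then have "g k \<le> (\<integral>\<^sup>+ \<omega>. ennreal (L / 2) * ennreal ((infdist (x k \<omega>) S)\<^sup>2) \<partial>P)"
      unfolding g_def by (intro nn_integral_mono)
    then show ?thesis by (simp add: a_def nn_integral_cmult)
  qed
  have lower: "ennreal (\<mu> / 2) * a k \<le> g k" for k
  proof -
    have "ennreal (\<mu> / 2) * ennreal ((infdist y S)\<^sup>2) \<le> ennreal (F y - m)" for y
      using convex_PL_quadratic_growth[OF F_cvx F_smooth L \<mu> PL argmin_F, of y] \<mu>
      by (subst ennreal_mult[symmetric]) (auto simp: S_def m_def intro!: ennreal_leI)
    then have "(\<integral>\<^sup>+ \<omega>. ennreal (\<mu> / 2) * ennreal ((infdist (x k \<omega>) S)\<^sup>2) \<partial>P) \<le> g k"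
      unfolding g_def by (intro nn_integral_mono)
    then show ?thesis by (simp add: a_def nn_integral_cmult)
  qed

  \<comment> \<open>The range of \<open>q\<close>\<close>
  define c where "c = A + M * C"
  have c: "0 \<le> c" using constants M by (simp add: c_def)
  \<comment> \<open>Since division by 0 gives 0, the step size condition is stated for
    \<open>c \<noteq> 0\<close>. For \<open>c = 0\<close> the bound reads as infinity, and
    \<open>\<alpha> * c = 0\<close> is below 1 at once.\<close>
  have \<alpha>c: "\<alpha> * c < 1" using \<alpha>_less[folded c_def] c by (cases "c = 0") (auto simp: field_simps)
  have BM: "0 \<le> B / M" "B / M < \<rho>" using constants M by (auto simp: field_simps)
  have q_less: "q < 1" using \<alpha>c BM \<alpha> \<mu> unfolding q c_def[symmetric] by simp
  have q1: "1 - \<alpha> * \<mu> * (1 - \<alpha> * (A + M * C)) \<le> q" and q2: "1 + B / M - \<rho> \<le> q"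
    unfolding q by simp_all
  have q_nonneg: "0 \<le> q" using q2 BM constants by simp
  \<comment> \<open>The exception is genuine: if \<open>A = B = C = 0\<close>,
    \<open>\<rho> = 1\<close> and all \<open>v k\<close> vanish, the iterates rest at a minimizer
    for every step size, and \<open>q = 0\<close> as soon as
    \<open>\<alpha> * \<mu> \<ge> 1\<close>.\<close>
  have q_pos: "0 < q" if not: "\<not> (x\<^sub>0 \<in> argmin F \<and> B = 0 \<and> \<rho> = 1)"
  proof (cases "B = 0 \<and> \<rho> = 1")
    case False
    \<comment> \<open>In this case the second entry of the maximum is already positive.\<close>
    have "0 < B / M \<or> \<rho> < 1" using False constants M by auto
    then have "0 < 1 + B / M - \<rho>" using BM constants by auto
    then show ?thesis using q2 by simp
  next
    case True
    with not have "x\<^sub>0 \<notin> argmin F" by simp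
    have gap: "0 < F x\<^sub>0 - m"
    proof (rule ccontr)
      assume "\<not> 0 < F x\<^sub>0 - m"
      then have "F x\<^sub>0 \<le> F y" for y using m_le[of y] by simp
      then have "x\<^sub>0 \<in> argmin F" by (simp add: mem_argmin_iff)
      with \<open>x\<^sub>0 \<notin> argmin F\<close> show False by contradiction
    qed
    have g0: "g 0 = ennreal (F x\<^sub>0 - m)"
    proof -
      have "g 0 = (\<integral>\<^sup>+ \<omega>. ennreal (F x\<^sub>0 - m) \<partial>P)"
        unfolding g_def by (intro nn_integral_cong) (simp add: x_0)
      then show ?thesis by (simp add: emeasure_space_1)
    qed
    have v0: "v 0 \<omega> = gradient (f (i 0 \<omega>)) x\<^sub>0 - e 0 \<omega>" if "\<omega> \<in> space P" for \<omega>
      using x_0[OF that] by (simp add: v_def)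
    \<comment> \<open>The first iterate is deterministic, so the variance bound with
      \<open>B = 0\<close> limits the gradient of \<open>F\<close> from above. The
      Polyak-Lojasiewicz condition limits it from below, and dividing by the positive gap yields
      \<open>\<mu> \<le> A\<close>.\<close>
    have "(norm (gradient F x\<^sub>0))\<^sup>2 \<le> 2 * A * (F x\<^sub>0 - m)"
    proof (rule norm_gradient_sq_le_second_moment[OF sub i_meas unif indep F diff e_mean])
      show "(\<lambda>\<omega>. gradient (f (i 0 \<omega>)) x\<^sub>0 - e 0 \<omega>) \<in> borel_measurable P"
        by (rule measurable_cong[THEN iffD1, OF v0 v_meas])
      have "(\<integral>\<^sup>+ \<omega>. ennreal ((norm (gradient (f (i 0 \<omega>)) x\<^sub>0 - e 0 \<omega>))\<^sup>2) \<partial>P) = N 0"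
        unfolding N_def by (intro nn_integral_cong) (simp add: v0)
      also have "\<dots> \<le> ennreal (2 * A) * ennreal (F x\<^sub>0 - m)"
        using var[of 0] True by (simp add: g0)
      also have "\<dots> = ennreal (2 * A * (F x\<^sub>0 - m))"
        using gap constants by (intro ennreal_mult[symmetric]) auto
      finally show "(\<integral>\<^sup>+ \<omega>. ennreal ((norm (gradient (f (i 0 \<omega>)) x\<^sub>0 - e 0 \<omega>))\<^sup>2) \<partial>P)
        \<le> ennreal (2 * A * (F x\<^sub>0 - m))" .
    qed (use gap constants in auto)
    moreover have "2 * \<mu> * (F x\<^sub>0 - m) \<le> (norm (gradient F x\<^sub>0))\<^sup>2"
      using PL \<mu> by (simp add: polyak_lojasiewicz_def m_def field_simps)
    ultimately have "\<mu> * (F x\<^sub>0 - m) \<le> A * (F x\<^sub>0 - m)" by simp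
    then have "\<mu> \<le> A" using gap by simp
    also have "A \<le> c" using constants M by (simp add: c_def)
    finally have "\<mu> \<le> c" .
    \<comment> \<open>The first factor is at most \<open>\<alpha> * c < 1\<close>, and
      \<open>1 - \<alpha> * c\<close> is below 1 because \<open>c \<ge> \<mu> > 0\<close>.\<close>
    then have "\<alpha> * \<mu> * (1 - \<alpha> * c) \<le> \<alpha> * c * (1 - \<alpha> * c)"
      using \<alpha>c \<alpha> by (intro mult_right_mono) auto
    also have "\<dots> \<le> 1 * (1 - \<alpha> * c)" using \<alpha>c by (intro mult_right_mono) auto
    also have "\<dots> < 1" using \<alpha> \<mu> \<open>\<mu> \<le> c\<close> by simp
    finally have "\<alpha> * \<mu> * (1 - \<alpha> * c) < 1" .
    then show ?thesis using q1 by (simp add: c_def)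
  qed

  \<comment> \<open>The recursion and the linear rates\<close>
  have V_eq: "V k = a k + ennreal (\<alpha>\<^sup>2 * M) * s k" for k
    unfolding V a_def s_def S_def ..
  have V_step: "V (Suc k) \<le> ennreal q * V k" if "0 < q \<or> a k < \<infinity>" for k
    unfolding V_eq
    by (rule lyapunov_step[OF constants(1-3) _ M(1) \<alpha> \<mu> q_nonneg _ q1 q2 step var rec upper lower that])
      (use constants L \<alpha>c in \<open>auto simp: c_def\<close>)
  have a_0: "a 0 = ennreal ((infdist x\<^sub>0 S)\<^sup>2)"
  proof -
    have "a 0 = (\<integral>\<^sup>+ \<omega>. ennreal ((infdist x\<^sub>0 S)\<^sup>2) \<partial>P)"
      unfolding a_def by (intro nn_integral_cong) (simp add: x_0)
    then show ?thesis by (simp add: emeasure_space_1)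
  qed
  have V_Suc: "V (Suc k) \<le> ennreal q * V k" for k
  proof (cases "0 < q")
    case False
    then have "q = 0" using q_nonneg by simp
    \<comment> \<open>\<open>a 0\<close> is finite because the starting point is deterministic; for
      \<open>q = 0\<close> every later value of \<open>V\<close> is 0, even if \<open>V 0\<close> is
      infinite.\<close>
    have "a k < \<infinity>"
    proof (induction k)
      case (Suc k)
      have "a (Suc k) \<le> V (Suc k)" by (simp add: V_eq)
      also have "\<dots> \<le> 0" using V_step[of k] Suc \<open>q = 0\<close> by simp
      finally show ?case by simp
    qed (simp add: a_0)
    then show ?thesis using V_step by blast
  qed (use V_step in blast)
  have V_pow: "V k \<le> ennreal (q ^ k) * V 0" for k
  proof (induction k)
    case (Suc k)
    have "V (Suc k) \<le> ennreal q * (ennreal (q ^ k) * V 0)"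
      using V_Suc[of k] Suc by (meson mult_left_mono order_trans zero_le)
    also have "\<dots> = ennreal (q ^ Suc k) * V 0"
      using q_nonneg by (simp add: ennreal_mult mult.assoc)
    finally show ?case .
  qed simp
  have a_pow: "a k \<le> ennreal (q ^ k) * V 0" for k
    by (rule order_trans[OF _ V_pow]) (simp add: V_eq)
  \<comment> \<open>Smoothness converts the rate for the squared distance into one for the gap,
    whence the factor \<open>L / 2\<close>.\<close>
  have g_pow: "g k \<le> ennreal (q ^ k * L / 2) * V 0" for k
  proof -
    have "g k \<le> ennreal (L / 2) * (ennreal (q ^ k) * V 0)"
      using upper[of k] a_pow[of k] by (meson mult_left_mono order_trans zero_le)
    also have "\<dots> = ennreal (q ^ k * L / 2) * V 0"
    proof -
      have "ennreal (L / 2) * ennreal (q ^ k) = ennreal (q ^ k * L / 2)"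
        using q_nonneg L by (subst ennreal_mult[symmetric]) (auto simp: mult.commute)
      then show ?thesis by (simp only: mult.assoc[symmetric])
    qed
    finally show ?thesis .
  qed
  have V_0: "V 0 = ennreal ((infdist x\<^sub>0 (argmin F))\<^sup>2)
      + ennreal (\<alpha>\<^sup>2 * M) * (\<integral>\<^sup>+ \<omega>. ennreal ((\<sigma> 0 \<omega>)\<^sup>2) \<partial>P)"
    by (simp add: V_eq a_0 s_def S_def)
  show ?thesis
    using q_nonneg q_less q_pos V_Suc a_pow g_pow
    unfolding V_0 unfolding a_def g_def S_def m_def by blast
qed

end
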